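(* Let $F$ be a field and $n\ge 2$. Suppose that $\operatorname{char}F\ne 2,3$ or that $F$ is perfect. If $\Omega^1_F\neq 0$, then $K^l\neq \Gamma^l$ for all $l\ge 2$.
   Context: For $i\ge 1$, $K^i$ denotes the subgroup of $SL_n(F[t])$ consisting of matrices congruent to the identity modulo $t^i$, and $K=K^1$. $\Gamma^\bullet$ denotes the lower central series of $K$: $\Gamma^1=K$, $\Gamma^{i+1}=[K,\Gamma^i]$. $\Omega^1_F=\Omega^1_{F/\mathbb{Z}}$ is the module of absolute Kähler differentials of $F$. *)

theory Defs
  imports
    "HOL-Library.Poly_Mapping"
    "HOL-Algebra.Generated_Groups"
    "Jordan_Normal_Form.Determinant"
begin

section \<open>The special linear group and its congruence subgroups\<close>

definition SL_group :: "nat \<Rightarrow> 'a::comm_ring_1 mat monoid" where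
  "SL_group n = \<lparr>carrier = {A \<in> carrier_mat n n. det A = 1}, monoid.mult = (*), one = 1\<^sub>m n\<rparr>"

lemma SL_group_simps [simp]:
  "carrier (SL_group n) = {A \<in> carrier_mat n n. det A = 1}"
  "monoid.mult (SL_group n) = (*)"
  "one (SL_group n) = 1\<^sub>m n"
  by (simp_all add: SL_group_def)

lemma group_SL_group: "group (SL_group n :: 'a::comm_ring_1 mat monoid)"
proof (rule groupI)
  fix A :: "'a mat" assume "A \<in> carrier (SL_group n)"
  hence A: "A \<in> carrier_mat n n" "det A = 1" by auto
  have B: "adj_mat A \<in> carrier_mat n n" "A * adj_mat A = 1\<^sub>m n" "adj_mat A * A = 1\<^sub>m n"
    using adj_mat[OF A(1)] A(2) by (auto simp: smult_mat_def intro!: eq_matI)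
  have "det A * det (adj_mat A) = 1"
    using det_mult[OF A(1) B(1)] B(2) by simp
  hence "det (adj_mat A) = 1" using A(2) by simp
  thus "\<exists>B\<in>carrier (SL_group n). B \<otimes>\<^bsub>SL_group n\<^esub> A = \<one>\<^bsub>SL_group n\<^esub>"
    using B by auto
qed (auto simp: det_mult)

text \<open>Here \<^term>\<open>[:0, 1:]\<close> is the indeterminate $t$.\<close>

definition congruence_subgroup :: "nat \<Rightarrow> nat \<Rightarrow> 'a::field poly mat set" where
  "congruence_subgroup n i =
     {A \<in> carrier (SL_group n).
        \<forall>r<n. \<forall>s<n. [:0, 1:] ^ i dvd A $$ (r, s) - 1\<^sub>m n $$ (r, s)}"

lemma subgroup_congruence_subgroup:
  "subgroup (congruence_subgroup n i :: 'a::field poly mat set) (SL_group n)"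
proof -
  interpret group "SL_group n :: 'a poly mat monoid" by (rule group_SL_group)
  have mult: "[:0, 1:] ^ i dvd (A * B) $$ (r, s) - B $$ (r, s)"
    if A: "A \<in> congruence_subgroup n i" and B: "B \<in> carrier_mat n n" and rs: "r < n" "s < n"
    for A B :: "'a poly mat" and r s
  proof -
    have Ac: "A \<in> carrier_mat n n" using A by (auto simp: congruence_subgroup_def)
    have "(\<Sum>k = 0..<n. 1\<^sub>m n $$ (r, k) * B $$ (k, s)) =
        (\<Sum>k = 0..<n. if k = r then B $$ (k, s) else 0)"
      using rs by (intro sum.cong) auto
    hence "(\<Sum>k = 0..<n. 1\<^sub>m n $$ (r, k) * B $$ (k, s)) = B $$ (r, s)"
      using rs by simp
    hence "(A * B) $$ (r, s) - B $$ (r, s) =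
        (\<Sum>k = 0..<n. (A $$ (r, k) - 1\<^sub>m n $$ (r, k)) * B $$ (k, s))"
      using Ac B rs
      by (simp del: index_one_mat add: scalar_prod_def sum_subtractf left_diff_distrib)
    also have "[:0, 1:] ^ i dvd \<dots>"
      using A rs by (intro dvd_sum dvd_mult2) (auto simp: congruence_subgroup_def)
    finally show ?thesis .
  qed
  show ?thesis
  proof (rule subgroupI)
    show "congruence_subgroup n i \<subseteq> carrier (SL_group n)"
      by (auto simp: congruence_subgroup_def)
    have "1\<^sub>m n \<in> congruence_subgroup n i"
      by (auto simp: congruence_subgroup_def)
    thus "congruence_subgroup n i \<noteq> {}" by blast
  next
    fix A :: "'a poly mat" assume A: "A \<in> congruence_subgroup n i"
    hence Ac: "A \<in> carrier (SL_group n)" by (auto simp: congruence_subgroup_def)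
    define B where "B = inv\<^bsub>SL_group n\<^esub> A"
    have Bc: "B \<in> carrier (SL_group n)" using Ac inv_closed unfolding B_def by blast
    have AB: "A * B = 1\<^sub>m n" using r_inv[OF Ac] by (simp add: B_def)
    have "[:0, 1:] ^ i dvd B $$ (r, s) - 1\<^sub>m n $$ (r, s)" if "r < n" "s < n" for r s
      using mult[OF A _ that, of B] Bc AB by (simp add: dvd_diff_commute)
    thus "inv\<^bsub>SL_group n\<^esub> A \<in> congruence_subgroup n i"
      using Bc unfolding B_def[symmetric] by (auto simp: congruence_subgroup_def)
  next
    fix A B :: "'a poly mat"
    assume A: "A \<in> congruence_subgroup n i" and B: "B \<in> congruence_subgroup n i"
    have c: "A \<in> carrier (SL_group n)" "B \<in> carrier (SL_group n)"
      using A B by (auto simp: congruence_subgroup_def)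
    have "[:0, 1:] ^ i dvd (A * B) $$ (r, s) - 1\<^sub>m n $$ (r, s)" if rs: "r < n" "s < n" for r s
    proof -
      have "[:0, 1:] ^ i dvd ((A * B) $$ (r, s) - B $$ (r, s)) + (B $$ (r, s) - 1\<^sub>m n $$ (r, s))"
        using mult[OF A _ rs, of B] B c rs by (intro dvd_add) (auto simp: congruence_subgroup_def)
      thus ?thesis by (simp del: index_mult_mat)
    qed
    moreover have "A * B \<in> carrier (SL_group n)" using m_closed[OF c] by simp
    ultimately show "A \<otimes>\<^bsub>SL_group n\<^esub> B \<in> congruence_subgroup n i"
      by (auto simp: congruence_subgroup_def)
  qed
qed


section \<open>Lower central series\<close>

definition commutator_subgroup :: "('a, 'b) monoid_scheme \<Rightarrow> 'a set \<Rightarrow> 'a set \<Rightarrow> 'a set" where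
  "commutator_subgroup G H L =
     generate G (\<Union>h\<in>H. \<Union>l\<in>L. {h \<otimes>\<^bsub>G\<^esub> l \<otimes>\<^bsub>G\<^esub> inv\<^bsub>G\<^esub> h \<otimes>\<^bsub>G\<^esub> inv\<^bsub>G\<^esub> l})"

text \<open>The lower central series of a subgroup \<^term>\<open>H\<close> of \<^term>\<open>G\<close>, indexed from 1; the value
  at index 0 is a dummy.\<close>

fun lower_central_series :: "('a, 'b) monoid_scheme \<Rightarrow> 'a set \<Rightarrow> nat \<Rightarrow> 'a set" where
  "lower_central_series G H 0 = H"
| "lower_central_series G H (Suc 0) = H"
| "lower_central_series G H (Suc (Suc i)) =
     commutator_subgroup G H (lower_central_series G H (Suc i))"


section \<open>Absolute Kaehler differentials\<close>

text \<open>
  The module of absolute differentials of a commutative ring $R$ is the free $R$-module on symbols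
  $dx$ for $x \in R$, modulo the submodule spanned by all $d(x+y) - dx - dy$ and
  $d(xy) - x\,dy - y\,dx$.  Elements of the free module are finitely supported functions $R \to R$,
  and $a\,dx$ is \<^term>\<open>Poly_Mapping.single x a\<close>.
\<close>

definition free_scale :: "'a::comm_ring_1 \<Rightarrow> ('b \<Rightarrow>\<^sub>0 'a) \<Rightarrow> ('b \<Rightarrow>\<^sub>0 'a)" where
  "free_scale a = Poly_Mapping.map ((*) a)"

lemma lookup_free_scale [simp]:
  "Poly_Mapping.lookup (free_scale a f) x = a * Poly_Mapping.lookup f x"
  by (simp add: free_scale_def Poly_Mapping.map.rep_eq when_def)

lemma free_scale_single [simp]:
  "free_scale a (Poly_Mapping.single x b) = Poly_Mapping.single x (a * b)"
  by (rule poly_mapping_eqI) (simp add: lookup_single when_def)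

interpretation free_module: Modules.module free_scale
  by unfold_locales (rule poly_mapping_eqI; simp add: lookup_add algebra_simps)+

definition kaehler_relations :: "('a::comm_ring_1 \<Rightarrow>\<^sub>0 'a) set" where
  "kaehler_relations =
     {Poly_Mapping.single (x + y) 1 - Poly_Mapping.single x 1 - Poly_Mapping.single y 1 | x y. True} \<union>
     {Poly_Mapping.single (x * y) 1 - Poly_Mapping.single y x - Poly_Mapping.single x y | x y. True}"

definition kaehler_equiv :: "('a::comm_ring_1 \<Rightarrow>\<^sub>0 'a) \<Rightarrow> ('a \<Rightarrow>\<^sub>0 'a) \<Rightarrow> bool" where
  "kaehler_equiv f g \<longleftrightarrow> f - g \<in> free_module.span kaehler_relations"

lemma equivp_kaehler_equiv: "equivp (kaehler_equiv :: ('a::comm_ring_1 \<Rightarrow>\<^sub>0 'a) \<Rightarrow> _)"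
proof (rule equivpI)
  show "reflp (kaehler_equiv :: ('a \<Rightarrow>\<^sub>0 'a) \<Rightarrow> _)"
    by (rule reflpI) (simp add: kaehler_equiv_def free_module.span_zero)
  show "symp (kaehler_equiv :: ('a \<Rightarrow>\<^sub>0 'a) \<Rightarrow> _)"
    unfolding symp_def kaehler_equiv_def by (metis free_module.span_neg minus_diff_eq)
  show "transp (kaehler_equiv :: ('a \<Rightarrow>\<^sub>0 'a) \<Rightarrow> _)"
  proof (rule transpI)
    fix f g h :: "'a \<Rightarrow>\<^sub>0 'a" assume "kaehler_equiv f g" "kaehler_equiv g h"
    hence "(f - g) + (g - h) \<in> free_module.span kaehler_relations"
      unfolding kaehler_equiv_def by (rule free_module.span_add)
    thus "kaehler_equiv f h" by (simp add: kaehler_equiv_def)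
  qed
qed

quotient_type (overloaded) 'a kaehler = "'a::comm_ring_1 \<Rightarrow>\<^sub>0 'a" / kaehler_equiv
  by (rule equivp_kaehler_equiv)

instantiation kaehler :: (comm_ring_1) ab_group_add
begin

lift_definition zero_kaehler :: "'a kaehler" is "0" .

lift_definition plus_kaehler :: "'a kaehler \<Rightarrow> 'a kaehler \<Rightarrow> 'a kaehler" is "(+)"
  unfolding kaehler_equiv_def by (metis add_diff_add free_module.span_add)

lift_definition uminus_kaehler :: "'a kaehler \<Rightarrow> 'a kaehler" is "uminus"
  unfolding kaehler_equiv_def by (metis free_module.span_neg minus_diff_minus)

lift_definition minus_kaehler :: "'a kaehler \<Rightarrow> 'a kaehler \<Rightarrow> 'a kaehler" is "(-)"
proof -
  fix f g f' g' :: "'a \<Rightarrow>\<^sub>0 'a" assume "kaehler_equiv f g" "kaehler_equiv f' g'"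
  hence "(f - g) - (f' - g') \<in> free_module.span kaehler_relations"
    unfolding kaehler_equiv_def by (rule free_module.span_diff)
  thus "kaehler_equiv (f - f') (g - g')" by (simp add: kaehler_equiv_def algebra_simps)
qed

instance
  by standard (transfer; simp add: kaehler_equiv_def algebra_simps free_module.span_zero)+

end

lift_definition kaehler_scale :: "'a::comm_ring_1 \<Rightarrow> 'a kaehler \<Rightarrow> 'a kaehler" is free_scale
  unfolding kaehler_equiv_def
  by (metis free_module.scale_right_diff_distrib free_module.span_scale)

lift_definition kaehler_d :: "'a::comm_ring_1 \<Rightarrow> 'a kaehler" is "\<lambda>x. Poly_Mapping.single x 1" .

interpretation kaehler: Modules.module kaehler_scale
  by unfold_locales
    (transfer; simp add: kaehler_equiv_def free_module.scale_right_distrib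
      free_module.scale_left_distrib free_module.span_zero)+

lemma kaehler_d_add: "kaehler_d (x + y) = kaehler_d x + kaehler_d y"
  by transfer (auto simp: kaehler_equiv_def kaehler_relations_def diff_diff_eq[symmetric]
      intro!: free_module.span_base)

lemma kaehler_d_mult:
  "kaehler_d (x * y) = kaehler_scale x (kaehler_d y) + kaehler_scale y (kaehler_d x)"
  by transfer (auto simp: kaehler_equiv_def kaehler_relations_def diff_diff_eq[symmetric]
      intro!: free_module.span_base)

text \<open>The universal property: derivations factor uniquely through \<^const>\<open>kaehler_d\<close>.\<close>

lemma kaehler_universal:
  fixes scale :: "'a::comm_ring_1 \<Rightarrow> 'b::ab_group_add \<Rightarrow> 'b" and D :: "'a \<Rightarrow> 'b"
  assumes "Modules.module scale"
    and D_add: "\<And>x y. D (x + y) = D x + D y"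
    and D_mult: "\<And>x y. D (x * y) = scale x (D y) + scale y (D x)"
  shows "\<exists>!\<phi>. Modules.module_hom kaehler_scale scale \<phi> \<and> (\<forall>x. \<phi> (kaehler_d x) = D x)"
proof -
  interpret target: Modules.module scale by fact
  define \<phi>0 where "\<phi>0 f = (\<Sum>x\<in>Poly_Mapping.keys f. scale (Poly_Mapping.lookup f x) (D x))"
    for f
  have \<phi>0_alt: "\<phi>0 f = (\<Sum>x\<in>X. scale (Poly_Mapping.lookup f x) (D x))"
    if "finite X" "Poly_Mapping.keys f \<subseteq> X" for f X
    unfolding \<phi>0_def using that by (intro sum.mono_neutral_left) (auto simp: in_keys_iff)
  have \<phi>0_add: "\<phi>0 (f + g) = \<phi>0 f + \<phi>0 g" for f g
    unfolding \<phi>0_def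
    by (rule setsum_keys_plus_distrib) (simp_all add: target.scale_left_distrib)
  have \<phi>0_scale: "\<phi>0 (free_scale a f) = scale a (\<phi>0 f)" for a f
  proof -
    have "Poly_Mapping.keys (free_scale a f) \<subseteq> Poly_Mapping.keys f"
      by (auto simp: in_keys_iff)
    hence "\<phi>0 (free_scale a f) =
        (\<Sum>x\<in>Poly_Mapping.keys f. scale (Poly_Mapping.lookup (free_scale a f) x) (D x))"
      by (intro \<phi>0_alt) auto
    thus ?thesis by (simp add: \<phi>0_def target.scale_sum_right)
  qed
  have \<phi>0_single: "\<phi>0 (Poly_Mapping.single x a) = scale a (D x)" for x a
    by (simp add: \<phi>0_def)
  interpret \<phi>0: Modules.module_hom free_scale scale \<phi>0
    by unfold_locales (simp_all add: \<phi>0_add \<phi>0_scale)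
  have rel: "\<phi>0 f = 0" if "f \<in> kaehler_relations" for f
    using that unfolding kaehler_relations_def
    by (auto simp: \<phi>0.diff \<phi>0_single D_add D_mult)
  have span: "\<phi>0 f = 0" if "f \<in> free_module.span kaehler_relations" for f
    using \<phi>0.eq_0_on_span[OF rel that] .
  have equiv: "\<phi>0 f = \<phi>0 g" if "kaehler_equiv f g" for f g
    using span[of "f - g"] that by (simp add: kaehler_equiv_def \<phi>0.diff)
  define \<phi> where "\<phi> w = \<phi>0 (rep_kaehler w)" for w
  have \<phi>_abs: "\<phi> (abs_kaehler f) = \<phi>0 f" for f
    unfolding \<phi>_def by (intro equiv Quotient3_rep_abs[OF Quotient3_kaehler])
      (simp add: kaehler_equiv_def free_module.span_zero)
  have hom: "Modules.module_hom kaehler_scale scale \<phi>"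
  proof unfold_locales
    fix v w :: "'a kaehler" and a :: 'a
    obtain f g where fg: "v = abs_kaehler f" "w = abs_kaehler g"
      by (metis Quotient3_abs_rep[OF Quotient3_kaehler])
    show "\<phi> (v + w) = \<phi> v + \<phi> w"
      by (simp add: fg plus_kaehler.abs_eq \<phi>_abs \<phi>0_add)
    show "\<phi> (kaehler_scale a v) = scale a (\<phi> v)"
      by (simp add: fg kaehler_scale.abs_eq \<phi>_abs \<phi>0_scale)
  qed
  have \<phi>_d: "\<phi> (kaehler_d x) = D x" for x
    by (simp add: kaehler_d.abs_eq \<phi>_abs \<phi>0_single)
  have uniq: "\<psi> w = \<phi> w"
    if psi: "Modules.module_hom kaehler_scale scale \<psi>" "\<forall>x. \<psi> (kaehler_d x) = D x" for \<psi> w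
  proof -
    interpret \<psi>: Modules.module_hom kaehler_scale scale \<psi> by fact
    obtain f where f: "w = abs_kaehler f"
      by (metis Quotient3_abs_rep[OF Quotient3_kaehler])
    have single: "\<psi> (abs_kaehler (Poly_Mapping.single x a)) = scale a (D x)" for x a
      using psi(2) \<psi>.scale[of a "kaehler_d x"]
      by (simp add: kaehler_d.abs_eq kaehler_scale.abs_eq)
    have "f = (\<Sum>x\<in>Poly_Mapping.keys f. Poly_Mapping.single x (Poly_Mapping.lookup f x))"
      by (rule poly_mapping_eqI)
        (auto simp: lookup_sum lookup_single when_def in_keys_iff)
    moreover have "\<psi> (abs_kaehler (\<Sum>x\<in>X. Poly_Mapping.single x (h x))) = (\<Sum>x\<in>X. scale (h x) (D x))"
      if "finite X" for X h
      using that
    proof induction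
      case empty
      show ?case using \<psi>.zero by (simp add: zero_kaehler.abs_eq)
    next
      case (insert x X)
      thus ?case
        by (simp add: plus_kaehler.abs_eq[symmetric] \<psi>.add single)
    qed
    ultimately have "\<psi> (abs_kaehler f) = \<phi>0 f"
      unfolding \<phi>0_def by (metis finite_keys)
    thus ?thesis by (simp add: f \<phi>_abs)
  qed
  show ?thesis
    by (rule ex1I[of _ \<phi>]) (use hom \<phi>_d uniq in auto)
qed


section \<open>Perfect fields\<close>

definition is_perfect_field :: "'a::field itself \<Rightarrow> bool" where
  "is_perfect_field _ \<longleftrightarrow> CHAR('a) = 0 \<or> surj (\<lambda>x::'a. x ^ CHAR('a))"

end

theory Submission
  imports Defs "Jordan_Normal_Form.Column_Operations"
    "HOL-Computational_Algebra.Formal_Laurent_Series"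
begin

text \<open>
  A derivation \<open>d\<close> of \<open>F\<close> with \<open>d u \<noteq> 0\<close> exists because \<open>\<Omega>\<close> is nonzero. Let \<open>D\<close> be its
  coefficientwise extension to \<open>Q = F((1/t))\<close>, let \<open>E = d/dt\<close>, and let \<open>res\<close> be the coefficient of
  \<open>t^0\<close>. Then \<open>c(g, h) = res tr (g\<^sup>-\<^sup>1 D g \<cdot> E h h\<^sup>-\<^sup>1)\<close> is a 2-cocycle on \<open>SL\<^sub>n(Q)\<close> with values in \<open>F\<close>.
  Its symbol \<open>res (D a / a \<cdot> E b / b)\<close> vanishes, because \<open>D a / a\<close> has degree at most \<open>0\<close> and
  \<open>E b / b\<close> has negative degree in \<open>t\<close>, and so the central extension of \<open>c\<close> splits, in the
  spirit of Matsumoto's theorem. On matrices over the localisation of \<open>F[t]\<close> at \<open>0\<close> that are lower unitriangular modulo \<open>t\<close>, the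
  splitting is given by \<open>L B \<mapsto> c(L, B)\<close> for the factorisation into a lower unitriangular \<open>L\<close> and an
  upper triangular \<open>B\<close>. On \<open>K\<close> the cocycle itself is zero for the trivial reason that \<open>D g\<close> is
  divisible by \<open>t\<close>. Comparing the two splittings gives a homomorphism \<open>K \<rightarrow> F\<close>. It kills \<open>[K, K]\<close>,
  but takes the value \<open>d u\<close> on every \<open>K\<^sup>l\<close>.
\<close>

section \<open>The cocycle attached to two derivations\<close>

definition derivation :: "('a::comm_ring_1 \<Rightarrow> 'a) \<Rightarrow> bool" where
  "derivation d \<longleftrightarrow>
     (\<forall>x y. d (x + y) = d x + d y) \<and> (\<forall>x y. d (x * y) = x * d y + d x * y)"

lemma derivation_add: "derivation d \<Longrightarrow> d (x + y) = d x + d y"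
  and derivation_mult: "derivation d \<Longrightarrow> d (x * y) = x * d y + d x * y"
  by (auto simp: derivation_def)

lemma derivation_0: "derivation d \<Longrightarrow> d 0 = 0"
  using derivation_add[of d 0 0] by simp

lemma derivation_1: "derivation d \<Longrightarrow> d 1 = 0"
  using derivation_mult[of d 1 1] by simp

lemma derivation_minus: "derivation d \<Longrightarrow> d (- x) = - d x"
  using derivation_add[of d x "- x"] derivation_0[of d] by (simp add: minus_unique)

lemma derivation_sum: "derivation d \<Longrightarrow> d (sum f A) = (\<Sum>x\<in>A. d (f x))"
  by (induction A rule: infinite_finite_induct) (auto simp: derivation_0 derivation_add)

lemma derivation_divide:
  fixes d :: "'a::field \<Rightarrow> 'a"
  assumes "derivation d" "y \<noteq> 0"
  shows "d (x / y) = d x / y - x * d y / (y * y)"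
proof -
  have "d (x / y * y) = x / y * d y + d (x / y) * y"
    by (rule derivation_mult[OF assms(1)])
  thus ?thesis using assms(2) by (simp add: field_simps)
qed

lemma map_mat_derivation_mult:
  assumes d: "derivation d" and A: "A \<in> carrier_mat n n" and B: "B \<in> carrier_mat n n"
  shows "map_mat d (A * B) = A * map_mat d B + map_mat d A * B"
  using A B
  by (intro eq_matI)
    (auto simp: scalar_prod_def derivation_sum[OF d] derivation_mult[OF d] sum.distrib)

definition mat_trace :: "'a::comm_ring_1 mat \<Rightarrow> 'a" where
  "mat_trace A = (\<Sum>i<dim_row A. A $$ (i, i))"

lemma mat_trace_mult:
  assumes "A \<in> carrier_mat n n" "B \<in> carrier_mat n n"
  shows "mat_trace (A * B) = (\<Sum>i<n. \<Sum>j<n. A $$ (i, j) * B $$ (j, i))"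
  using assms unfolding mat_trace_def
  by (auto simp: scalar_prod_def lessThan_atLeast0 intro!: sum.cong)

lemma mat_trace_mult_commute:
  assumes "A \<in> carrier_mat n n" "B \<in> carrier_mat n n"
  shows "mat_trace (A * B) = mat_trace (B * A)"
  unfolding mat_trace_mult[OF assms] mat_trace_mult[OF assms(2,1)]
  by (subst sum.swap) (simp only: mult.commute)

text \<open>Cyclicity of the trace, in the shape that moves a conjugation from one factor to the
  other; this is what makes the two mixed terms of the cocycle identity agree.\<close>

lemma mat_trace_conjugate:
  assumes "P \<in> carrier_mat n n" "A \<in> carrier_mat n n" "Q \<in> carrier_mat n n" "B \<in> carrier_mat n n"
  shows "mat_trace (P * A * Q * B) = mat_trace (A * (Q * B * P))"
proof -
  have "mat_trace (P * A * Q * B) = mat_trace (P * (A * Q * B))"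
    using assms by (simp add: assoc_mult_mat[of _ n n _ n _ n])
  also have "\<dots> = mat_trace (A * Q * B * P)"
    using assms by (intro mat_trace_mult_commute[of _ n]) auto
  also have "\<dots> = mat_trace (A * (Q * B * P))"
    using assms by (simp add: assoc_mult_mat[of _ n n _ n _ n])
  finally show ?thesis .
qed

lemma mat_trace_add:
  assumes "A \<in> carrier_mat n n" "B \<in> carrier_mat n n"
  shows "mat_trace (A + B) = mat_trace A + mat_trace B"
  using assms by (simp add: mat_trace_def sum.distrib)

section \<open>Matrices of determinant one and their logarithmic derivatives\<close>

abbreviation SL :: "nat \<Rightarrow> 'a::comm_ring_1 mat set" where
  "SL n \<equiv> {A \<in> carrier_mat n n. det A = 1}"

lemma SL_D:
  assumes "A \<in> SL n"
  shows "A \<in> carrier_mat n n" "det A = 1" "adj_mat A \<in> carrier_mat n n"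
    "A * adj_mat A = 1\<^sub>m n" "adj_mat A * A = 1\<^sub>m n"
proof -
  have A: "A \<in> carrier_mat n n" "det A = 1" using assms by auto
  thus "A \<in> carrier_mat n n" "det A = 1" "adj_mat A \<in> carrier_mat n n"
    "A * adj_mat A = 1\<^sub>m n" "adj_mat A * A = 1\<^sub>m n"
    using adj_mat[OF A(1)] by (auto simp: smult_mat_def intro!: eq_matI)
qed

lemma SL_mult: "A \<in> SL n \<Longrightarrow> B \<in> SL n \<Longrightarrow> A * B \<in> SL n"
  by (auto simp: det_mult)

lemma SL_adj:
  assumes "A \<in> SL n" shows "adj_mat A \<in> SL n"
  using det_mult[OF SL_D(1)[OF assms] SL_D(3)[OF assms]] SL_D[OF assms] by simp

lemma SL_cancel:
  assumes "A \<in> SL n" "X \<in> carrier_mat n m"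
  shows "A * (adj_mat A * X) = X" "adj_mat A * (A * X) = X"
proof -
  note A = SL_D[OF assms(1)]
  show "A * (adj_mat A * X) = X"
    unfolding assoc_mult_mat[OF A(1,3) assms(2), symmetric] A(4) by (rule left_mult_one_mat[OF assms(2)])
  show "adj_mat A * (A * X) = X"
    unfolding assoc_mult_mat[OF A(3,1) assms(2), symmetric] A(5) by (rule left_mult_one_mat[OF assms(2)])
qed

lemma SL_mult_left_cancel:
  fixes A :: "'a::comm_ring_1 mat"
  assumes "A \<in> SL n" "X \<in> carrier_mat n m" "Y \<in> carrier_mat n m" "A * X = A * Y"
  shows "X = Y"
  using SL_cancel(2)[OF assms(1,2)] SL_cancel(2)[OF assms(1,3)] unfolding assms(4) by (rule trans[OF sym])

lemma adj_mat_mult: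
  fixes A :: "'a::comm_ring_1 mat"
  assumes A: "A \<in> SL n" and B: "B \<in> SL n"
  shows "adj_mat (A * B) = adj_mat B * adj_mat A"
proof (rule SL_mult_left_cancel[OF SL_mult[OF A B]])
  note a = SL_D[OF A] and b = SL_D[OF B] and ab = SL_D[OF SL_mult[OF A B]]
  show "adj_mat (A * B) \<in> carrier_mat n n" "adj_mat B * adj_mat A \<in> carrier_mat n n"
    using a b ab by auto
  have "(A * B) * (adj_mat B * adj_mat A) = 1\<^sub>m n"
    using a b by (simp add: assoc_mult_mat[of _ n n _ n _ n] SL_cancel[OF B])
  thus "(A * B) * adj_mat (A * B) = (A * B) * (adj_mat B * adj_mat A)"
    using ab by simp
qed

text \<open>On \<open>SL n\<close> the adjugate is the inverse, so this is the left logarithmic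
  derivative. With the adjugate it makes sense over polynomials as well as over fields and can be
  transported along ring homomorphisms.\<close>

definition ldlog :: "('a::comm_ring_1 \<Rightarrow> 'a) \<Rightarrow> 'a mat \<Rightarrow> 'a mat" where
  "ldlog d A = adj_mat A * map_mat d A"

definition rdlog :: "('a::comm_ring_1 \<Rightarrow> 'a) \<Rightarrow> 'a mat \<Rightarrow> 'a mat" where
  "rdlog d A = map_mat d A * adj_mat A"

lemma ldlog_carrier: "A \<in> SL n \<Longrightarrow> ldlog d A \<in> carrier_mat n n"
  and rdlog_carrier: "A \<in> SL n \<Longrightarrow> rdlog d A \<in> carrier_mat n n"
  unfolding ldlog_def rdlog_def
  by (rule mult_carrier_mat[OF SL_D(3)], assumption, simp)
    (rule mult_carrier_mat[OF _ SL_D(3)], simp, assumption)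

lemma mult_ldlog:
  assumes "A \<in> SL n" shows "A * ldlog d A = map_mat d A"
  unfolding ldlog_def by (rule SL_cancel(1)[OF assms]) (use SL_D(1)[OF assms] in auto)

lemma rdlog_mult:
  assumes "A \<in> SL n" shows "rdlog d A * A = map_mat d A"
proof -
  note A = SL_D[OF assms]
  have m: "map_mat d A \<in> carrier_mat n n" using A(1) by simp
  show ?thesis
    unfolding rdlog_def assoc_mult_mat[OF m A(3) A(1)] A(5) by (rule right_mult_one_mat[OF m])
qed

lemma ldlog_mult:
  assumes d: "derivation d" and A: "A \<in> SL n" and B: "B \<in> SL n"
  shows "ldlog d (A * B) = ldlog d B + adj_mat B * ldlog d A * B"
proof -
  note a = SL_D[OF A] and b = SL_D[OF B]
  have "ldlog d (A * B) = adj_mat B * (adj_mat A * (A * map_mat d B + map_mat d A * B))"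
    using a b by (simp add: ldlog_def adj_mat_mult[OF A B] map_mat_derivation_mult[OF d]
        assoc_mult_mat[of _ n n _ n _ n])
  also have "adj_mat A * (A * map_mat d B + map_mat d A * B) = map_mat d B + ldlog d A * B"
    using a b by (simp add: ldlog_def mult_add_distrib_mat[of _ n n _ n]
        assoc_mult_mat[of _ n n _ n _ n] SL_cancel[OF A])
  finally show ?thesis using a b ldlog_carrier[OF A, of d]
    by (simp add: ldlog_def[of d B] mult_add_distrib_mat[of _ n n _ n]
        assoc_mult_mat[of _ n n _ n _ n])
qed

lemma rdlog_mult_left:
  assumes d: "derivation d" and A: "A \<in> SL n" and B: "B \<in> SL n"
  shows "rdlog d (A * B) = rdlog d A + A * rdlog d B * adj_mat A"
proof -
  note a = SL_D[OF A] and b = SL_D[OF B]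
  have "rdlog d (A * B) = ((A * map_mat d B + map_mat d A * B) * adj_mat B) * adj_mat A"
    using a b by (simp add: rdlog_def adj_mat_mult[OF A B] map_mat_derivation_mult[OF d]
        assoc_mult_mat[of _ n n _ n _ n])
  also have "(A * map_mat d B + map_mat d A * B) * adj_mat B =
      A * rdlog d B + map_mat d A * (B * adj_mat B)"
    using a b by (simp add: rdlog_def add_mult_distrib_mat[of _ n n _ _ n]
        assoc_mult_mat[of _ n n _ n _ n])
  also have "(A * rdlog d B + map_mat d A * (B * adj_mat B)) * adj_mat A =
      A * rdlog d B * adj_mat A + rdlog d A"
    using a b rdlog_carrier[OF B, of d]
    by (simp add: rdlog_def[of d A] add_mult_distrib_mat[of _ n n _ _ n])
  finally show ?thesis
    using a b rdlog_carrier[OF B, of d] rdlog_carrier[OF A, of d]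
    by (subst comm_add_mat[of _ n n]) auto
qed

definition dlog_cocycle :: "('a::comm_ring_1 \<Rightarrow> 'a) \<Rightarrow> ('a \<Rightarrow> 'a) \<Rightarrow> 'a mat \<Rightarrow> 'a mat \<Rightarrow> 'a" where
  "dlog_cocycle d e A B = mat_trace (ldlog d A * rdlog e B)"

text \<open>The product rules for \<open>ldlog\<close> and \<open>rdlog\<close> expand both sides
  into the pairings of \<open>A\<close> with \<open>B\<close> and of \<open>B\<close> with
  \<open>C\<close>, plus one mixed term. The mixed terms pair \<open>A\<close> with \<open>C\<close>
  after conjugation by \<open>B\<close>, applied to the left factor on one side and to the right
  factor on the other; the trace does not see the difference.\<close>

lemma dlog_cocycle:
  assumes d: "derivation d" and e: "derivation e"
    and A: "A \<in> SL n" and B: "B \<in> SL n" and C: "C \<in> SL n"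
  shows "dlog_cocycle d e A B + dlog_cocycle d e (A * B) C =
         dlog_cocycle d e B C + dlog_cocycle d e A (B * C)"
proof -
  note b = SL_D[OF B]
  note al = ldlog_carrier[OF A, of d] ldlog_carrier[OF B, of d]
    rdlog_carrier[OF B, of e] rdlog_carrier[OF C, of e]
  note bs = b(1,3)
  let ?P = "adj_mat B * ldlog d A * B" and ?Q = "B * rdlog e C * adj_mat B"
  have carr: "?P \<in> carrier_mat n n" "?Q \<in> carrier_mat n n"
    using al bs by (metis mult_carrier_mat)+
  have "mat_trace ((ldlog d B + ?P) * rdlog e C) =
      mat_trace (ldlog d B * rdlog e C) + mat_trace (?P * rdlog e C)"
    unfolding add_mult_distrib_mat[OF al(2) carr(1) al(4)]
    by (rule mat_trace_add[OF mult_carrier_mat[OF al(2,4)] mult_carrier_mat[OF carr(1) al(4)]])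
  moreover have "mat_trace (ldlog d A * (rdlog e B + ?Q)) =
      mat_trace (ldlog d A * rdlog e B) + mat_trace (ldlog d A * ?Q)"
    unfolding mult_add_distrib_mat[OF al(1,3) carr(2)]
    by (rule mat_trace_add[OF mult_carrier_mat[OF al(1,3)] mult_carrier_mat[OF al(1) carr(2)]])
  moreover have "mat_trace (?P * rdlog e C) = mat_trace (ldlog d A * ?Q)"
    by (rule mat_trace_conjugate[OF bs(2) al(1) bs(1) al(4)])
  ultimately show ?thesis
    unfolding dlog_cocycle_def ldlog_mult[OF d A B] rdlog_mult_left[OF e B C] by simp
qed

section \<open>Triangular matrices\<close>

definition upper_tri :: "nat \<Rightarrow> 'a::comm_ring_1 mat \<Rightarrow> bool" where
  "upper_tri n A \<longleftrightarrow> (\<forall>i<n. \<forall>j<i. A $$ (i, j) = 0)"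

definition lower_unitri :: "nat \<Rightarrow> 'a::comm_ring_1 mat \<Rightarrow> bool" where
  "lower_unitri n A \<longleftrightarrow> (\<forall>i<n. A $$ (i, i) = 1 \<and> (\<forall>j<n. i < j \<longrightarrow> A $$ (i, j) = 0))"

lemma mult_index: 
  assumes "A \<in> carrier_mat n n" "B \<in> carrier_mat n n" "i < n" "j < n"
  shows "(A * B) $$ (i, j) = (\<Sum>k<n. A $$ (i, k) * B $$ (k, j))"
  using assms by (auto simp: scalar_prod_def lessThan_atLeast0)

lemma sum_lessThan_eq_subset:
  fixes f :: "nat \<Rightarrow> 'a::comm_monoid_add"
  assumes "S \<subseteq> {..<n}" "\<And>k. k < n \<Longrightarrow> k \<notin> S \<Longrightarrow> f k = 0"
  shows "(\<Sum>k<n. f k) = sum f S"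
  using assms by (intro sum.mono_neutral_right) auto

text \<open>Rows are treated from the bottom up. Below the diagonal, entry \<open>(i, j)\<close> of
  \<open>B * X\<close> reduces to \<open>B $$ (i, i) * X $$ (i, j)\<close>: earlier indices are
  killed by \<open>B\<close>, later ones by the induction hypothesis.\<close>

lemma upper_tri_left_quotient:
  fixes B :: "'a::field mat"
  assumes c: "B \<in> carrier_mat n n" "X \<in> carrier_mat n n"
    and B: "upper_tri n B" "\<And>i. i < n \<Longrightarrow> B $$ (i, i) \<noteq> 0"
    and C: "upper_tri n (B * X)"
  shows "upper_tri n X"
proof -
  have "i < n \<Longrightarrow> j < i \<Longrightarrow> X $$ (i, j) = 0" for i j
  proof (induction "n - i" arbitrary: i rule: less_induct)
    case less
    have "(B * X) $$ (i, j) = (\<Sum>k<n. B $$ (i, k) * X $$ (k, j))"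
      using c less.prems by (intro mult_index) auto
    also have "\<dots> = (\<Sum>k\<in>{i}. B $$ (i, k) * X $$ (k, j))"
    proof (rule sum_lessThan_eq_subset)
      fix k assume k: "k < n" "k \<notin> {i}"
      show "B $$ (i, k) * X $$ (k, j) = 0"
      proof (cases "k < i")
        case True thus ?thesis using B(1) less.prems by (simp add: upper_tri_def)
      next
        case False
        hence "X $$ (k, j) = 0" using k less.prems by (intro less.hyps) auto
        thus ?thesis by simp
      qed
    qed (use less.prems in auto)
    finally show ?case using C B(2)[of i] less.prems by (simp add: upper_tri_def del: index_mult_mat)
  qed
  thus ?thesis by (simp add: upper_tri_def)
qed

text \<open>The mirror image of the left quotient, with columns treated from left to right.\<close>

lemma upper_tri_right_quotient:
  fixes B :: "'a::field mat"
  assumes c: "B \<in> carrier_mat n n" "X \<in> carrier_mat n n"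
    and B: "upper_tri n B" "\<And>i. i < n \<Longrightarrow> B $$ (i, i) \<noteq> 0"
    and C: "upper_tri n (X * B)"
  shows "upper_tri n X"
proof -
  have "i < n \<Longrightarrow> j < i \<Longrightarrow> X $$ (i, j) = 0" for i j
  proof (induction j rule: less_induct)
    case (less j)
    have "(X * B) $$ (i, j) = (\<Sum>k<n. X $$ (i, k) * B $$ (k, j))"
      using c less.prems by (intro mult_index) auto
    also have "\<dots> = (\<Sum>k\<in>{j}. X $$ (i, k) * B $$ (k, j))"
    proof (rule sum_lessThan_eq_subset)
      fix k assume k: "k < n" "k \<notin> {j}"
      show "X $$ (i, k) * B $$ (k, j) = 0"
      proof (cases "k < j")
        case True
        hence "X $$ (i, k) = 0" using k less.prems by (intro less.IH) auto
        thus ?thesis by simp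
      next
        case False thus ?thesis using B(1) k less.prems by (simp add: upper_tri_def)
      qed
    qed (use less.prems in auto)
    finally show ?case using C B(2)[of j] less.prems by (simp add: upper_tri_def del: index_mult_mat)
  qed
  thus ?thesis by (simp add: upper_tri_def)
qed

lemma upper_tri_mult_diag:
  assumes "B \<in> carrier_mat n n" "X \<in> carrier_mat n n" "upper_tri n B" "upper_tri n X" "i < n"
  shows "(B * X) $$ (i, i) = B $$ (i, i) * X $$ (i, i)"
proof -
  have "(B * X) $$ (i, i) = (\<Sum>k<n. B $$ (i, k) * X $$ (k, i))"
    using assms by (intro mult_index) auto
  also have "\<dots> = (\<Sum>k\<in>{i}. B $$ (i, k) * X $$ (k, i))"
  proof (rule sum_lessThan_eq_subset)
    fix k assume "k < n" "k \<notin> {i}"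
    thus "B $$ (i, k) * X $$ (k, i) = 0"
      using assms by (cases "k < i") (auto simp: upper_tri_def)
  qed (use assms in auto)
  finally show ?thesis by simp
qed

lemma upper_tri_mult_superdiag:
  assumes "B \<in> carrier_mat n n" "X \<in> carrier_mat n n" "upper_tri n B" "upper_tri n X"
    "Suc i < n"
  shows "(B * X) $$ (i, Suc i) =
    B $$ (i, i) * X $$ (i, Suc i) + B $$ (i, Suc i) * X $$ (Suc i, Suc i)"
proof -
  have "(B * X) $$ (i, Suc i) = (\<Sum>k<n. B $$ (i, k) * X $$ (k, Suc i))"
    using assms by (intro mult_index) auto
  also have "\<dots> = (\<Sum>k\<in>{i, Suc i}. B $$ (i, k) * X $$ (k, Suc i))"
  proof (rule sum_lessThan_eq_subset)
    fix k assume "k < n" "k \<notin> {i, Suc i}"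
    thus "B $$ (i, k) * X $$ (k, Suc i) = 0"
      using assms by (cases "k < i") (auto simp: upper_tri_def)
  qed (use assms in auto)
  finally show ?thesis by simp
qed

lemma upper_tri_mult:
  assumes "B \<in> carrier_mat n n" "X \<in> carrier_mat n n" "upper_tri n B" "upper_tri n X"
  shows "upper_tri n (B * X)"
  unfolding upper_tri_def
proof (intro allI impI)
  fix i j assume ij: "i < n" "j < i"
  have "(B * X) $$ (i, j) = (\<Sum>k<n. B $$ (i, k) * X $$ (k, j))"
    using assms ij by (intro mult_index) auto
  also have "\<dots> = 0"
  proof (intro sum.neutral ballI)
    fix k assume "k \<in> {..<n}"
    thus "B $$ (i, k) * X $$ (k, j) = 0"
      using assms ij by (cases "k < i") (auto simp: upper_tri_def)
  qed
  finally show "(B * X) $$ (i, j) = 0" .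
qed

lemma upper_tri_map_derivation:
  assumes "derivation d" "B \<in> carrier_mat n n" "upper_tri n B"
  shows "upper_tri n (map_mat d B)"
  using assms by (auto simp: upper_tri_def derivation_0)

lemma upper_tri_diag_nonzero:
  fixes B :: "'a::idom mat"
  assumes "B \<in> SL n" "upper_tri n B" "i < n"
  shows "B $$ (i, i) \<noteq> 0"
proof -
  have B: "B \<in> carrier_mat n n" "det B = 1" using assms by auto
  have "upper_triangular B" using assms B by (auto simp: upper_tri_def)
  hence "det B = prod_list (diag_mat B)" by (rule det_upper_triangular[OF _ B(1)])
  hence "0 \<notin> set (diag_mat B)" using B(2) by (metis prod_list_zero_iff zero_neq_one)
  thus ?thesis using B(1) assms(3) by (auto simp: diag_mat_def image_iff)
qed

text \<open>All three parts come from comparing entries in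
  \<open>B * ldlog d B = map_mat d B\<close>. The diagonal serves for pairing two triangular
  matrices, the first superdiagonal for pairing with a simple lower transvection.\<close>

lemma upper_tri_ldlog:
  fixes B :: "'a::field mat"
  assumes d: "derivation d" and B: "B \<in> SL n" "upper_tri n B"
  shows "upper_tri n (ldlog d B)"
    and "i < n \<Longrightarrow> ldlog d B $$ (i, i) = d (B $$ (i, i)) / B $$ (i, i)"
    and "Suc i < n \<Longrightarrow> ldlog d B $$ (i, Suc i) = d (B $$ (i, Suc i)) / B $$ (i, i)
      - B $$ (i, Suc i) * d (B $$ (Suc i, Suc i)) / (B $$ (i, i) * B $$ (Suc i, Suc i))"
proof -
  note b = SL_D[OF B(1)] and nz = upper_tri_diag_nonzero[OF B] and l = ldlog_carrier[OF B(1), of d]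
  show u: "upper_tri n (ldlog d B)"
    by (rule upper_tri_left_quotient[OF b(1) l B(2) nz])
      (simp_all add: mult_ldlog[OF B(1)] upper_tri_map_derivation[OF d b(1) B(2)])
  have diag: "d (B $$ (i, i)) = B $$ (i, i) * ldlog d B $$ (i, i)" if "i < n" for i
    using upper_tri_mult_diag[OF b(1) l B(2) u that] b(1) that by (simp add: mult_ldlog[OF B(1)])
  thus 2: "i < n \<Longrightarrow> ldlog d B $$ (i, i) = d (B $$ (i, i)) / B $$ (i, i)"
    using nz[of i] by simp
  show "ldlog d B $$ (i, Suc i) = d (B $$ (i, Suc i)) / B $$ (i, i)
      - B $$ (i, Suc i) * d (B $$ (Suc i, Suc i)) / (B $$ (i, i) * B $$ (Suc i, Suc i))"
    if i: "Suc i < n"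
    using upper_tri_mult_superdiag[OF b(1) l B(2) u i] b(1) i nz[of i] nz[of "Suc i"] diag[of "Suc i"]
    by (simp add: mult_ldlog[OF B(1)] field_simps)
qed

lemma upper_tri_rdlog:
  fixes B :: "'a::field mat"
  assumes d: "derivation d" and B: "B \<in> SL n" "upper_tri n B"
  shows "upper_tri n (rdlog d B)"
    and "i < n \<Longrightarrow> rdlog d B $$ (i, i) = d (B $$ (i, i)) / B $$ (i, i)"
    and "Suc i < n \<Longrightarrow> rdlog d B $$ (i, Suc i) = d (B $$ (i, Suc i)) / B $$ (Suc i, Suc i)
      - B $$ (i, Suc i) * d (B $$ (i, i)) / (B $$ (i, i) * B $$ (Suc i, Suc i))"
proof -
  note b = SL_D[OF B(1)] and nz = upper_tri_diag_nonzero[OF B] and l = rdlog_carrier[OF B(1), of d]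
  show u: "upper_tri n (rdlog d B)"
    by (rule upper_tri_right_quotient[OF b(1) l B(2) nz])
      (simp_all add: rdlog_mult[OF B(1)] upper_tri_map_derivation[OF d b(1) B(2)])
  have diag: "d (B $$ (i, i)) = rdlog d B $$ (i, i) * B $$ (i, i)" if "i < n" for i
    using upper_tri_mult_diag[OF l b(1) u B(2) that] b(1) that by (simp add: rdlog_mult[OF B(1)])
  thus 2: "i < n \<Longrightarrow> rdlog d B $$ (i, i) = d (B $$ (i, i)) / B $$ (i, i)"
    using nz[of i] by simp
  show "rdlog d B $$ (i, Suc i) = d (B $$ (i, Suc i)) / B $$ (Suc i, Suc i)
      - B $$ (i, Suc i) * d (B $$ (i, i)) / (B $$ (i, i) * B $$ (Suc i, Suc i))"
    if i: "Suc i < n"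
    using upper_tri_mult_superdiag[OF l b(1) u B(2) i] b(1) i nz[of i] nz[of "Suc i"] diag[of "i"]
    by (simp add: rdlog_mult[OF B(1)] field_simps)
qed

text \<open>The trace of a product of upper triangular matrices sees only the diagonals, so the
  cocycle becomes a sum of symbols, each a product of two scalar logarithmic derivatives.\<close>

lemma dlog_cocycle_upper_tri:
  fixes A B :: "'a::field mat"
  assumes d: "derivation d" and e: "derivation e"
    and A: "A \<in> SL n" "upper_tri n A" and B: "B \<in> SL n" "upper_tri n B"
  shows "dlog_cocycle d e A B =
    (\<Sum>i<n. d (A $$ (i, i)) / A $$ (i, i) * (e (B $$ (i, i)) / B $$ (i, i)))"
proof -
  note l = ldlog_carrier[OF A(1), of d] rdlog_carrier[OF B(1), of e]
  have "dlog_cocycle d e A B = (\<Sum>i<n. (ldlog d A * rdlog e B) $$ (i, i))"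
    using l by (simp add: dlog_cocycle_def mat_trace_def)
  also have "\<dots> = (\<Sum>i<n. ldlog d A $$ (i, i) * rdlog e B $$ (i, i))"
    using l upper_tri_ldlog(1)[OF d A] upper_tri_rdlog(1)[OF e B]
    by (intro sum.cong refl upper_tri_mult_diag) auto
  finally show ?thesis
    by (simp add: upper_tri_ldlog(2)[OF d A] upper_tri_rdlog(2)[OF e B])
qed


lemma SL_mult_right_cancel:
  fixes A :: "'a::comm_ring_1 mat"
  assumes A: "A \<in> SL n" and X: "X \<in> carrier_mat n n" and Y: "Y \<in> carrier_mat n n"
    and eq: "X * A = Y * A"
  shows "X = Y"
proof -
  note a = SL_D[OF A]
  have "X = (X * A) * adj_mat A"
    unfolding assoc_mult_mat[OF X a(1,3)] a(4) right_mult_one_mat[OF X] ..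
  also have "\<dots> = Y"
    unfolding eq assoc_mult_mat[OF Y a(1,3)] a(4) right_mult_one_mat[OF Y] ..
  finally show ?thesis .
qed

section \<open>Elementary and lower unitriangular matrices\<close>

definition single_mat :: "nat \<Rightarrow> nat \<Rightarrow> nat \<Rightarrow> 'a::comm_ring_1 \<Rightarrow> 'a mat" where
  "single_mat n i j a = mat n n (\<lambda>(r, s). if r = i \<and> s = j then a else 0)"

lemma single_mat_carrier [simp]: "single_mat n i j a \<in> carrier_mat n n"
  by (simp add: single_mat_def)

lemma mat_trace_mult_single_mat:
  assumes "A \<in> carrier_mat n n" "i < n" "j < n"
  shows "mat_trace (A * single_mat n i j a) = A $$ (j, i) * a"
proof -
  have "mat_trace (A * single_mat n i j a) =
      (\<Sum>r<n. \<Sum>s<n. if s = i then if r = j then A $$ (r, s) * a else 0 else 0)"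
    unfolding mat_trace_mult[OF assms(1) single_mat_carrier]
    using assms by (intro sum.cong refl) (auto simp: single_mat_def)
  also have "\<dots> = A $$ (j, i) * a" using assms by simp
  finally show ?thesis .
qed

lemma mat_trace_single_mat_mult:
  assumes "A \<in> carrier_mat n n" "i < n" "j < n"
  shows "mat_trace (single_mat n i j a * A) = a * A $$ (j, i)"
  using mat_trace_mult_single_mat[OF assms] mat_trace_mult_commute[OF assms(1) single_mat_carrier]
  by (simp add: mult.commute)

lemma addrow_mat_SL: "i \<noteq> j \<Longrightarrow> addrow_mat n a i j \<in> SL n"
  by (simp add: det_addrow_mat)

text \<open>A derivation kills the constants 0 and 1, leaving one off-diagonal entry, and
  multiplying that by the transvection changes nothing because a matrix unit with
  \<open>i \<noteq> j\<close> squares to zero.\<close>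

lemma
  assumes d: "derivation d" and ij: "i < n" "j < n" "i \<noteq> j"
  shows ldlog_addrow_mat: "ldlog d (addrow_mat n a i j) = single_mat n i j (d a)"
    and rdlog_addrow_mat: "rdlog d (addrow_mat n a i j) = single_mat n i j (d a)"
proof -
  note e = addrow_mat_SL[OF ij(3), of n a]
  have m: "map_mat d (addrow_mat n a i j) = single_mat n i j (d a)"
    using ij by (intro eq_matI) (auto simp: single_mat_def derivation_0[OF d] derivation_1[OF d])
  have "addrow_mat n a i j * single_mat n i j (d a) = single_mat n i j (d a)"
    unfolding addrow_mat[OF single_mat_carrier ij(2), symmetric]
    using ij by (intro eq_matI) (auto simp: single_mat_def)
  thus "ldlog d (addrow_mat n a i j) = single_mat n i j (d a)"
    using mult_ldlog[OF e, of d] m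
    by (intro SL_mult_left_cancel[OF e ldlog_carrier[OF e] single_mat_carrier]) simp
  have "single_mat n i j (d a) * addrow_mat n a i j = single_mat n i j (d a)"
    unfolding addcol_mat[OF single_mat_carrier ij(1), symmetric]
    using ij by (intro eq_matI) (auto simp: single_mat_def)
  thus "rdlog d (addrow_mat n a i j) = single_mat n i j (d a)"
    using rdlog_mult[OF e, of d] m
    by (intro SL_mult_right_cancel[OF e rdlog_carrier[OF e] single_mat_carrier]) simp
qed

text \<open>In \<open>L * ldlog d L = map_mat d L\<close> the right-hand side vanishes on and above
  the diagonal, since \<open>d\<close> kills 0 and 1. As \<open>L\<close> is unitriangular, the
  equations can be solved row by row from the top.\<close>

lemma lower_unitri_ldlog:
  fixes L :: "'a::comm_ring_1 mat"
  assumes d: "derivation d" and L: "L \<in> SL n" "lower_unitri n L" and ij: "i \<le> j" "j < n"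
  shows "ldlog d L $$ (i, j) = 0"
  using ij
proof (induction i rule: less_induct)
  case (less i)
  note l = SL_D(1)[OF L(1)]
  have "0 = (L * ldlog d L) $$ (i, j)"
    unfolding mult_ldlog[OF L(1)] using L(2) l less.prems
    by (cases "i = j") (auto simp: lower_unitri_def derivation_0[OF d] derivation_1[OF d])
  also have "\<dots> = (\<Sum>k<n. L $$ (i, k) * ldlog d L $$ (k, j))"
    using less.prems by (intro mult_index l ldlog_carrier L) auto
  also have "\<dots> = (\<Sum>k\<in>{i}. L $$ (i, k) * ldlog d L $$ (k, j))"
  proof (rule sum_lessThan_eq_subset)
    fix k assume k: "k < n" "k \<notin> {i}"
    show "L $$ (i, k) * ldlog d L $$ (k, j) = 0"
    proof (cases "k < i")
      case True
      thus ?thesis using less.IH[of k] less.prems by simp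
    next
      case False
      thus ?thesis using k L(2) less.prems by (simp add: lower_unitri_def)
    qed
  qed (use less.prems in auto)
  also have "\<dots> = ldlog d L $$ (i, j)"
    using L(2) less.prems by (simp add: lower_unitri_def)
  finally show ?case by simp
qed

lemma lower_unitri_mult_addrow:
  assumes L: "L \<in> carrier_mat n n" "lower_unitri n L" and k: "Suc k < n"
  shows "lower_unitri n (L * addrow_mat n u (Suc k) k)"
proof -
  have "L * addrow_mat n u (Suc k) k = addcol u k (Suc k) L"
    using addcol_mat[OF L(1) k] by simp
  thus ?thesis using L k by (auto simp: lower_unitri_def)
qed

text \<open>The left-hand side is the cocycle of an upper triangular \<open>2 \<times> 2\<close> block with entries
  \<open>p, q, r\<close> against the elementary matrix with lower entry \<open>u\<close>; the difference is a sum of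
  products of logarithmic derivatives.\<close>

lemma rank_one_identity:
  fixes p :: "'a::field"
  assumes "p \<noteq> 0" "q \<noteq> 0" "r \<noteq> 0" "u \<noteq> 0" and w: "w = p + u * q" "w \<noteq> 0"
    and wd: "dw = dp + u * dq + du * q" and we: "fw = fp + u * fq + fu * q"
  shows "fu * (dq / p - q * dr / (p * r)) -
      ((du * r + u * dr) / w - u * r * dw / (w * w)) * (w * fq - q * fw) / (p * r) =
    dr / r * (fp / p) + (dp / p * (fq / q) + dw / w * (fw / w) + dq / q * (fw / w)) -
      (dr / r * (fw / w) + dw / w * (fq / q) + dp / p * (fw / w) + dq / q * (fp / p))"
proof -
  \<comment> \<open>Multiplying by the common denominator leaves a polynomial identity, in which
    \<open>w\<close> and its two derivatives are then expanded.\<close>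
  have "(fu * (dq / p - q * dr / (p * r)) -
      ((du * r + u * dr) / w - u * r * dw / (w * w)) * (w * fq - q * fw) / (p * r) -
    (dr / r * (fp / p) + (dp / p * (fq / q) + dw / w * (fw / w) + dq / q * (fw / w)) -
      (dr / r * (fw / w) + dw / w * (fq / q) + dp / p * (fw / w) + dq / q * (fp / p)))) *
     (p * q * r * w * w) = 0"
    using assms(1-4) w(2) apply (simp add: divide_simps)
    unfolding wd we w(1) by (simp add: algebra_simps)
  thus ?thesis using assms by simp
qed

section \<open>Splitting of the cocycle\<close>

lemma SL_mult_assoc:
  assumes "A \<in> SL n" "B \<in> SL n" "C \<in> SL n"
  shows "(A * B) * C = A * (B * C)"
  using assms by (intro assoc_mult_mat[of _ n n _ n _ n]) auto

text \<open>Here \<open>R\<close> is a subring, \<open>M\<close> an ideal of \<open>R\<close> for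
  which \<open>1 + M\<close> consists of units with inverses again in \<open>1 + M\<close>, and
  \<open>res\<close> an additive map that kills every symbol. In the application \<open>R\<close>
  consists of the fractions regular at \<open>t = 0\<close> and \<open>M\<close> of those vanishing
  there.\<close>

locale dlog_pairing =
  fixes D E :: "'q::field \<Rightarrow> 'q" and res :: "'q \<Rightarrow> 'f::ab_group_add"
    and R M :: "'q set" and n :: nat
  assumes D: "derivation D" and E: "derivation E"
    and res_add: "res (x + y) = res x + res y"
    and res_dlog: "res (D a / a * (E b / b)) = 0"
    and R_1: "1 \<in> R" and R_minus: "x \<in> R \<Longrightarrow> - x \<in> R"
    and R_mult: "x \<in> R \<Longrightarrow> y \<in> R \<Longrightarrow> x * y \<in> R"
    and R_add: "x \<in> R \<Longrightarrow> y \<in> R \<Longrightarrow> x + y \<in> R"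
    and M_0: "0 \<in> M" and M_R: "x \<in> M \<Longrightarrow> x \<in> R"
    and M_add: "x \<in> M \<Longrightarrow> y \<in> M \<Longrightarrow> x + y \<in> M"
    and M_mult: "x \<in> R \<Longrightarrow> y \<in> M \<Longrightarrow> x * y \<in> M"
    and unit: "x - 1 \<in> M \<Longrightarrow> x \<noteq> 0 \<and> inverse x - 1 \<in> M"
begin

lemma M_minus: "x \<in> M \<Longrightarrow> - x \<in> M"
  using M_mult[OF R_minus[OF R_1]] by simp

lemma M_diff: "x \<in> M \<Longrightarrow> y \<in> M \<Longrightarrow> x - y \<in> M"
  using M_add[OF _ M_minus, of x y] by simp

lemma one_unit_R: "x - 1 \<in> M \<Longrightarrow> x \<in> R"
  using R_add[OF M_R R_1, of "x - 1"] by simp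

lemma one_unit_add: "x - 1 \<in> M \<Longrightarrow> m \<in> M \<Longrightarrow> x + m - 1 \<in> M"
  using M_add[of "x - 1" m] by (simp add: algebra_simps)

lemma one_unit_mult: "x - 1 \<in> M \<Longrightarrow> y - 1 \<in> M \<Longrightarrow> x * y - 1 \<in> M"
  using M_add[OF M_mult[OF one_unit_R[of x], of "y - 1"], of "x - 1"] by (simp add: algebra_simps)

lemma M_sum: "(\<And>k. k \<in> S \<Longrightarrow> f k \<in> M) \<Longrightarrow> sum f S \<in> M"
  by (induction S rule: infinite_finite_induct) (auto intro: M_0 M_add)

lemma res_0: "res 0 = 0"
  using res_add[of 0 0] by simp

lemma res_minus: "res (- x) = - res x"
  using res_add[of x "- x"] by (simp add: res_0 eq_neg_iff_add_eq_0 add.commute)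

lemma res_diff: "res (x - y) = res x - res y"
  using res_add[of x "- y"] by (simp add: res_minus)

lemma res_sum: "res (sum f A) = (\<Sum>x\<in>A. res (f x))"
  by (induction A rule: infinite_finite_induct) (auto simp: res_0 res_add)

section \<open>The cocycle on the two triangular factors\<close>

definition coc :: "'q mat \<Rightarrow> 'q mat \<Rightarrow> 'f" where
  "coc A B = res (dlog_cocycle D E A B)"

lemma coc:
  assumes "A \<in> SL n" "B \<in> SL n" "C \<in> SL n"
  shows "coc A B + coc (A * B) C = coc B C + coc A (B * C)"
  unfolding coc_def res_add[symmetric] by (simp only: dlog_cocycle[OF D E assms])

lemma coc_upper_tri:
  assumes "A \<in> SL n" "upper_tri n A" "B \<in> SL n" "upper_tri n B"
  shows "coc A B = 0"
  unfolding coc_def dlog_cocycle_upper_tri[OF D E assms] res_sum by (simp only: res_dlog sum.neutral_const)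

text \<open>Upper triangular matrices congruent to the identity modulo \<open>M\<close>. Keeping the
  entries above the diagonal in \<open>M\<close> ensures that pivots stay in \<open>1 + M\<close>
  when a lower transvection with parameter in \<open>R\<close> is moved across.\<close>

definition borel :: "'q mat set" where
  "borel = {B \<in> SL n. upper_tri n B \<and> (\<forall>i<n. B $$ (i, i) - 1 \<in> M) \<and>
     (\<forall>i<n. \<forall>j<n. i < j \<longrightarrow> B $$ (i, j) \<in> M)}"

abbreviation low :: "'q \<Rightarrow> nat \<Rightarrow> 'q mat" where
  "low u k \<equiv> addrow_mat n u (Suc k) k"

text \<open>Generated by transvections at adjacent indices only, because these are the ones that can
  be exchanged with \<open>borel\<close> by a two-by-two computation; \<open>addrow_lower\<close>
  recovers the others.\<close>

inductive_set lower :: "'q mat set" where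
  one: "1\<^sub>m n \<in> lower"
| step: "L \<in> lower \<Longrightarrow> Suc k < n \<Longrightarrow> u \<in> R \<Longrightarrow> L * low u k \<in> lower"

lemma low_SL: "low u k \<in> SL n"
  by (rule addrow_mat_SL) simp

lemma coc_low_right:
  assumes "A \<in> SL n" "Suc k < n"
  shows "coc A (low u k) = res (ldlog D A $$ (k, Suc k) * E u)"
  unfolding coc_def dlog_cocycle_def
  using assms by (simp add: rdlog_addrow_mat[OF E] mat_trace_mult_single_mat[OF ldlog_carrier])

lemma coc_low_left:
  assumes "A \<in> SL n" "Suc k < n"
  shows "coc (low u k) A = res (D u * rdlog E A $$ (k, Suc k))"
  unfolding coc_def dlog_cocycle_def
  using assms by (simp add: ldlog_addrow_mat[OF D] mat_trace_single_mat_mult[OF rdlog_carrier])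

lemma lower_SL: "L \<in> lower \<Longrightarrow> L \<in> SL n \<and> lower_unitri n L"
proof (induction rule: lower.induct)
  case one
  show ?case by (simp add: lower_unitri_def)
next
  case (step L k u)
  thus ?case
    using SL_mult[of L n "low u k"] low_SL[of u k] lower_unitri_mult_addrow[of L n k u] by auto
qed

text \<open>Pairing with \<open>low u k\<close> reads only entry \<open>(k, Suc k)\<close> of
  \<open>ldlog D L\<close>, which lies above the diagonal and so vanishes.\<close>

lemma coc_lower_low:
  assumes "L \<in> lower" "Suc k < n"
  shows "coc L (low u k) = 0"
proof -
  have "L \<in> SL n" "lower_unitri n L" using lower_SL[OF assms(1)] by auto
  hence "ldlog D L $$ (k, Suc k) = 0"
    using assms(2) by (intro lower_unitri_ldlog[OF D]) auto
  thus ?thesis using \<open>L \<in> SL n\<close> assms(2) by (simp add: coc_low_right res_0)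
qed

lemma lower_mult: "L' \<in> lower \<Longrightarrow> L \<in> lower \<Longrightarrow> L * L' \<in> lower"
proof (induction rule: lower.induct)
  case one
  have "L * 1\<^sub>m n = L" using lower_SL[OF one] by (intro right_mult_one_mat) auto
  thus ?case using one by simp
next
  case (step L' k u)
  have "L * (L' * low u k) = L * L' * low u k"
    using lower_SL[OF step.prems] lower_SL[OF step.hyps(1)] low_SL[of u k]
    by (intro SL_mult_assoc[symmetric, of _ n]) auto
  thus ?case using lower.step[OF step.IH[OF step.prems] step.hyps(2,3)] by simp
qed

lemma low_lower:
  assumes "Suc k < n" "u \<in> R"
  shows "low u k \<in> lower"
  using lower.step[OF lower.one assms] low_SL[of u k] by simp

lemma borel_D: 
  assumes "B \<in> borel"
  shows "B \<in> SL n" "upper_tri n B" "i < n \<Longrightarrow> B $$ (i, i) - 1 \<in> M" "i < j \<Longrightarrow> j < n \<Longrightarrow> B $$ (i, j) \<in> M"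
  using assms by (auto simp: borel_def)

lemma borel_mult:
  assumes "A \<in> borel" "B \<in> borel"
  shows "A * B \<in> borel"
proof -
  note a = borel_D[OF assms(1)] and b = borel_D[OF assms(2)]
  have c: "A \<in> carrier_mat n n" "B \<in> carrier_mat n n" using a(1) b(1) by auto
  have "(A * B) $$ (i, i) - 1 \<in> M" if "i < n" for i
    unfolding upper_tri_mult_diag[OF c a(2) b(2) that]
    by (intro one_unit_mult a(3) b(3) that)
  moreover have "(A * B) $$ (i, j) \<in> M" if ij: "i < j" "j < n" for i j
  proof -
    have "(A * B) $$ (i, j) = (\<Sum>k<n. A $$ (i, k) * B $$ (k, j))"
      using ij by (intro mult_index c) auto
    also have "\<dots> = (\<Sum>k\<in>{i..j}. A $$ (i, k) * B $$ (k, j))"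
      using a(2) b(2) ij
      by (intro sum_lessThan_eq_subset) (auto simp: upper_tri_def not_le)
    also have "\<dots> \<in> M"
    proof (rule M_sum)
      \<comment> \<open>Since \<open>i < j\<close>, at least one of the two factors sits strictly
        above the diagonal and hence in \<open>M\<close>.\<close>
      fix k assume k: "k \<in> {i..j}"
      show "A $$ (i, k) * B $$ (k, j) \<in> M"
      proof (cases "k = i")
        case True
        thus ?thesis using M_mult[OF one_unit_R[OF a(3)] b(4)] ij k by auto
      next
        case False
        have "B $$ (k, j) \<in> R"
          using one_unit_R[OF b(3)] M_R[OF b(4)] ij k by (cases "k = j") auto
        thus ?thesis using M_mult[of "B $$ (k, j)" "A $$ (i, k)"] a(4)[of i k] ij k False
          by (simp add: mult.commute)
      qed
    qed
    finally show ?thesis .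
  qed
  ultimately show ?thesis
    using SL_mult[OF a(1) b(1)] upper_tri_mult[OF c a(2) b(2)] by (simp add: borel_def)
qed

lemma coc_borel: "A \<in> borel \<Longrightarrow> B \<in> borel \<Longrightarrow> coc A B = 0"
  by (intro coc_upper_tri borel_D)

lemma res_rank_one:
  assumes nz: "p \<noteq> 0" "r \<noteq> 0" and w: "w = p + u * q" "w \<noteq> 0"
  shows "res ((D q / p - q * D r / (p * r)) * E u) =
    res (D (u * r / w) * (E q / (p * r / w) - q * E w / (w * (p * r / w))))"
proof (cases "q = 0 \<or> u = 0")
  case True
  thus ?thesis by (auto simp: derivation_0[OF D] derivation_0[OF E] res_0)
next
  case False
  have wd: "D w = D p + u * D q + D u * q" and we: "E w = E p + u * E q + E u * q"
    unfolding w(1) by (simp_all add: derivation_add[OF D] derivation_mult[OF D]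
        derivation_add[OF E] derivation_mult[OF E])
  have "(D q / p - q * D r / (p * r)) * E u -
      D (u * r / w) * (E q / (p * r / w) - q * E w / (w * (p * r / w))) =
    E u * (D q / p - q * D r / (p * r)) -
      ((D u * r + u * D r) / w - u * r * D w / (w * w)) * (w * E q - q * E w) / (p * r)"
    using nz w(2) by (simp add: derivation_divide[OF D] derivation_mult[OF D] field_simps)
  also have "\<dots> = D r / r * (E p / p) +
      (D p / p * (E q / q) + D w / w * (E w / w) + D q / q * (E w / w)) -
      (D r / r * (E w / w) + D w / w * (E q / q) + D p / p * (E w / w) + D q / q * (E p / p))"
    by (rule rank_one_identity) (use False nz w wd we in auto)
  finally have "res ((D q / p - q * D r / (p * r)) * E u) -
      res (D (u * r / w) * (E q / (p * r / w) - q * E w / (w * (p * r / w)))) = 0"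
    unfolding res_diff[symmetric] by (simp only: res_diff res_add res_dlog add_0 diff_0_right)
  thus ?thesis by simp
qed

text \<open>The exchange relation behind the splitting. Only rows and columns \<open>k\<close> and
  \<open>Suc k\<close> matter: \<open>low u k\<close> creates a single entry below the diagonal, a
  transvection on the left removes it, and the two cocycle values agree by
  \<open>res_rank_one\<close>.\<close>

lemma borel_low:
  assumes B: "B \<in> borel" and k: "Suc k < n" and u: "u \<in> R"
  obtains y B' where "y \<in> R" "B' \<in> borel" "B * low u k = low y k * B'"
    "coc B (low u k) = coc (low y k) B'"
proof -
  note b = borel_D[OF B]
  have c: "B \<in> carrier_mat n n" using b(1) by auto
  define p q r where pqr: "p = B $$ (k, k)" "q = B $$ (k, Suc k)" "r = B $$ (Suc k, Suc k)"
  define w where "w = p + u * q"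
  \<comment> \<open>After the column operation, column \<open>k\<close> has pivot \<open>w\<close>
    and the entry \<open>u * r\<close> below it; \<open>y\<close> is their ratio.\<close>
  define y where "y = u * r / w"
  have pr: "p - 1 \<in> M" "r - 1 \<in> M" "q \<in> M"
    using b(3,4) k by (auto simp: pqr)
  have w: "w - 1 \<in> M" unfolding w_def by (intro one_unit_add pr M_mult u)
  have nz: "p \<noteq> 0" "r \<noteq> 0" "w \<noteq> 0" using unit pr w by auto
  have iw: "inverse w - 1 \<in> M" using unit w by auto
  have y: "y \<in> R" unfolding y_def divide_inverse
    by (intro R_mult u one_unit_R pr iw)
  define B' where "B' = addrow (- y) (Suc k) k (addcol u k (Suc k) B)"
  have Bl: "B * low u k = addcol u k (Suc k) B"
    using addcol_mat[OF c k] by simp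
  have c1: "addcol u k (Suc k) B \<in> carrier_mat n n" using c unfolding carrier_mat_def by simp
  have B': "B' = low (- y) k * (B * low u k)"
    unfolding B'_def Bl using addrow_mat[OF c1] k by simp
  have inv: "low y k * low (- y) k = 1\<^sub>m n"
    using k by (intro addrow_mat_inv) auto
  have B'SL: "B' \<in> SL n" unfolding B' by (intro SL_mult low_SL b(1))
  have "low y k * B' = (low y k * low (- y) k) * (B * low u k)"
    unfolding B' by (rule SL_mult_assoc[symmetric, OF low_SL low_SL SL_mult[OF b(1) low_SL]])
  also have "\<dots> = B * low u k" unfolding inv Bl by (rule left_mult_one_mat[OF c1])
  finally have eq: "B * low u k = low y k * B'" ..
  have ent: "B' $$ (i, j) =
      (if i = Suc k then - y * ((if j = k then u * B $$ (k, Suc k) else 0) + B $$ (k, j)) else 0) +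
      ((if j = k then u * B $$ (i, Suc k) else 0) + B $$ (i, j))" if "i < n" "j < n" for i j
    unfolding B'_def using that c k by auto
  have ut: "upper_tri n B'"
    unfolding upper_tri_def
  proof (intro allI impI)
    fix i j assume ij: "i < n" "j < i"
    show "B' $$ (i, j) = 0"
    proof (cases "i = Suc k \<and> j = k")
      case True
      have "B $$ (Suc k, k) = 0" using b(2) k by (simp add: upper_tri_def)
      moreover have "- y * (u * q + p) + u * r = 0"
        unfolding y_def w_def[symmetric] using nz by (simp add: w_def add.commute)
      ultimately show ?thesis using True k by (simp add: ent pqr)
    next
      case False
      thus ?thesis using ij b(2) k by (auto simp: ent upper_tri_def)
    qed
  qed
  have Bkk: "B' $$ (k, k) = w" "B' $$ (k, Suc k) = q" "B' $$ (Suc k, Suc k) = p * r / w"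
  proof -
    show "B' $$ (k, k) = w" "B' $$ (k, Suc k) = q" using k by (simp_all add: ent pqr w_def)
    \<comment> \<open>The block keeps its determinant \<open>p * r\<close>, so the new pivot
      \<open>w\<close> determines the other diagonal entry.\<close>
    have "r - u * r / w * q = p * r / w" using nz by (simp add: field_simps w_def)
    thus "B' $$ (Suc k, Suc k) = p * r / w" using k by (simp add: ent pqr y_def)
  qed
  have "B' $$ (i, i) - 1 \<in> M" if i: "i < n" for i
  proof -
    consider "i = k" | "i = Suc k" | "i \<noteq> k" "i \<noteq> Suc k" by blast
    thus ?thesis
    proof cases
      case 1 thus ?thesis using w Bkk by simp
    next
      case 2
      have "p * r / w - 1 \<in> M" unfolding divide_inverse by (intro one_unit_mult pr iw)
      thus ?thesis using Bkk 2 by simp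
    next
      case 3
      thus ?thesis using i b(3) by (simp add: ent)
    qed
  qed
  moreover have "B' $$ (i, j) \<in> M" if ij: "i < j" "j < n" for i j
  proof -
    have my: "y * B $$ (k, j) \<in> M" if "i = Suc k"
      using that ij b(4)[of k j] by (intro M_mult y) auto
    have mu: "u * B $$ (i, Suc k) \<in> M" if "j = k"
      using that ij k b(4)[of i "Suc k"] by (intro M_mult u) auto
    show ?thesis
      using ij k b(4)[of i j] my mu
      by (auto simp: ent intro: M_add M_diff)
  qed
  ultimately have "B' \<in> borel" using B'SL ut by (simp add: borel_def)
  moreover have "coc B (low u k) = coc (low y k) B'"
    unfolding coc_low_right[OF b(1) k] coc_low_left[OF B'SL k]
      upper_tri_ldlog(3)[OF D b(1,2) k] upper_tri_rdlog(3)[OF E B'SL ut k] Bkk pqr[symmetric]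
    unfolding y_def by (rule res_rank_one[OF nz(1,2) w_def nz(3)])
  ultimately show thesis using y eq that by blast
qed

section \<open>The lift to the central extension\<close>

text \<open>The pairs in \<open>split\<close> form the lift of the group \<open>lower \<cdot> borel\<close> to the central extension
  given by \<open>coc\<close>.\<close>

inductive split :: "'q mat \<Rightarrow> 'f \<Rightarrow> bool" where
  splitI: "L \<in> lower \<Longrightarrow> B \<in> borel \<Longrightarrow> split (L * B) (coc L B)"

lemma split_SL: "split g x \<Longrightarrow> g \<in> SL n"
  by (auto elim!: split.cases dest!: lower_SL borel_D(1) simp: det_mult)

text \<open>The new factor is absorbed into the Borel part; the cocycle identity gives the value
  because \<open>coc\<close> vanishes on pairs from \<open>borel\<close>.\<close>

lemma split_borel:
  assumes "split g x" "B \<in> borel"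
  shows "split (g * B) (x + coc g B)"
  using assms(1)
proof cases
  case (splitI L B0)
  note SL = conjunct1[OF lower_SL[OF splitI(3)]] borel_D(1)[OF splitI(4)] borel_D(1)[OF assms(2)]
  have "coc L B0 + coc (L * B0) B = coc L (B0 * B)"
    using coc[OF SL] coc_borel[OF splitI(4) assms(2)] by simp
  thus ?thesis
    using split.splitI[OF splitI(3) borel_mult[OF splitI(4) assms(2)]] SL_mult_assoc[OF SL]
    by (simp add: splitI(1,2))
qed

text \<open>The transvection is moved past the Borel factor by \<open>borel_low\<close> and absorbed
  into the lower factor. Two uses of the cocycle identity match the values, since
  \<open>coc_lower_low\<close> removes the remaining term.\<close>

lemma split_low:
  assumes "split g x" and k: "Suc k < n" and u: "u \<in> R"
  shows "split (g * low u k) (x + coc g (low u k))"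
  using assms(1)
proof cases
  case (splitI L B)
  obtain y B' where y: "y \<in> R" and B': "B' \<in> borel" and eq: "B * low u k = low y k * B'"
    and ceq: "coc B (low u k) = coc (low y k) B'"
    using borel_low[OF splitI(4) k u] by blast
  note L = conjunct1[OF lower_SL[OF splitI(3)]] and B = borel_D(1)[OF splitI(4)]
    and Bs = borel_D(1)[OF B']
  have "split ((L * low y k) * B') (coc (L * low y k) B')"
    by (intro split.splitI lower.step splitI(3) k y B')
  moreover have "(L * low y k) * B' = g * low u k"
    unfolding splitI(1) SL_mult_assoc[OF L low_SL Bs] SL_mult_assoc[OF L B low_SL] eq ..
  moreover have "coc (L * low y k) B' = x + coc g (low u k)"
  proof -
    have "coc (L * low y k) B' = coc B (low u k) + coc L (B * low u k)"
      using coc[OF L low_SL Bs, of y k] unfolding coc_lower_low[OF splitI(3) k] ceq eq by simp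
    also have "\<dots> = coc L B + coc (L * B) (low u k)"
      by (rule coc[OF L B low_SL, symmetric])
    finally show ?thesis unfolding splitI(1,2) .
  qed
  ultimately show ?thesis by simp
qed

lemma split_lower:
  assumes "L \<in> lower" "split g x"
  shows "split (g * L) (x + coc g L)"
  using assms
proof (induction rule: lower.induct)
  case one
  have g: "g \<in> SL n" by (rule split_SL[OF one])
  have "1\<^sub>m n \<in> borel" using M_0 by (auto simp: borel_def upper_tri_def)
  thus ?case by (rule split_borel[OF one])
next
  case (step L k u)
  note L = conjunct1[OF lower_SL[OF step.hyps(1)]] and g = split_SL[OF step.prems]
  have "split (g * L * low u k) (x + coc g L + coc (g * L) (low u k))"
    by (rule split_low[OF step.IH[OF step.prems] step.hyps(2,3)])
  moreover have "coc g L + coc (g * L) (low u k) = coc g (L * low u k)"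
    using coc[OF g L low_SL, of u k] coc_lower_low[OF step.hyps(1,2), of u] by simp
  ultimately show ?case
    unfolding SL_mult_assoc[OF g L low_SL] add.assoc by metis
qed

text \<open>Closure of the lift under the product of the central extension, obtained by multiplying
  first by the lower and then by the Borel factor of \<open>h\<close>.\<close>

theorem split_mult:
  assumes "split g x" "split h y"
  shows "split (g * h) (x + y + coc g h)"
  using assms(2)
proof cases
  case (splitI L B)
  note L = conjunct1[OF lower_SL[OF splitI(3)]] and g = split_SL[OF assms(1)]
    and B = borel_D(1)[OF splitI(4)]
  have "split (g * L * B) (x + coc g L + coc (g * L) B)"
    by (rule split_borel[OF split_lower[OF splitI(3) assms(1)] splitI(4)])
  moreover have "coc g L + coc (g * L) B = y + coc g h"
    unfolding splitI(1,2) by (rule coc[OF g L B])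
  ultimately show ?thesis
    unfolding splitI(1) SL_mult_assoc[OF g L B] add.assoc by metis
qed


text \<open>An upper triangular matrix that is also lower unitriangular is the identity, so the
  factorisation is unique and determines the value.\<close>

theorem split_unique:
  assumes "split g x" "split g y"
  shows "x = y"
  using assms(1)
proof cases
  case (splitI L1 B1)
  note 1 = splitI
  from assms(2) show ?thesis
  proof cases
    case (splitI L2 B2)
    have L1: "L1 \<in> SL n" "lower_unitri n L1" and L2: "L2 \<in> SL n" "lower_unitri n L2"
      using lower_SL[OF 1(3)] lower_SL[OF splitI(3)] by auto
    note B1 = borel_D(1,2)[OF 1(4)] and B2 = borel_D(1,2)[OF splitI(4)]
    note b1 = SL_D[OF B1(1)]
    \<comment> \<open>The discrepancy of the two factorisations: it is upper triangular as a
      quotient of Borel factors, and \<open>L2 * X = L1\<close> then forces its rows, one after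
      another, to be those of the identity.\<close>
    define X where "X = B2 * adj_mat B1"
    have X: "X \<in> SL n" unfolding X_def by (intro SL_mult SL_adj B1 B2)
    have XB: "X * B1 = B2"
      unfolding X_def SL_mult_assoc[OF B2(1) SL_adj[OF B1(1)] B1(1)] b1(5)
      using B2(1) by (auto intro!: right_mult_one_mat[of _ n])
    have "L2 * X = (L2 * B2) * adj_mat B1"
      unfolding X_def by (rule SL_mult_assoc[symmetric, OF L2(1) B2(1) SL_adj[OF B1(1)]])
    also have "\<dots> = L1"
      unfolding splitI(1)[symmetric] 1(1) SL_mult_assoc[OF L1(1) B1(1) SL_adj[OF B1(1)]] b1(4)
      using L1(1) by (auto intro!: right_mult_one_mat[of _ n])
    finally have LX: "L2 * X = L1" .
    have upX: "upper_tri n X"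
      using upper_tri_right_quotient[OF b1(1) SL_D(1)[OF X] B1(2)] XB B2(2)
        upper_tri_diag_nonzero[OF B1] by simp
    have X1: "j < n \<Longrightarrow> X $$ (i, j) = (if i = j then 1 else 0)" if "i < n" for i j
      using that
    proof (induction i arbitrary: j rule: less_induct)
      case (less i)
      show ?case
      proof (cases "j < i")
        case True
        thus ?thesis using upX less.prems by (simp add: upper_tri_def)
      next
        case False
        have "L1 $$ (i, j) = (\<Sum>k<n. L2 $$ (i, k) * X $$ (k, j))"
          unfolding LX[symmetric] using less.prems L2(1) X by (intro mult_index) auto
        also have "\<dots> = (\<Sum>k\<in>{i}. L2 $$ (i, k) * X $$ (k, j))"
        proof (rule sum_lessThan_eq_subset)
          fix k assume k: "k < n" "k \<notin> {i}"
          show "L2 $$ (i, k) * X $$ (k, j) = 0"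
          proof (cases "k < i")
            case True
            thus ?thesis using less.IH[of k j] less.prems False k by simp
          next
            case False
            thus ?thesis using k less.prems L2(2) by (simp add: lower_unitri_def)
          qed
        qed (use less.prems in auto)
        also have "\<dots> = X $$ (i, j)"
          using L2(2) less.prems by (simp add: lower_unitri_def)
        finally show ?thesis using L1(2) less.prems False by (auto simp: lower_unitri_def)
      qed
    qed
    have "X = 1\<^sub>m n" using X by (intro eq_matI) (auto simp: X1)
    hence "B1 = B2" "L1 = L2" using XB LX B1(1) L2(1) by auto
    thus ?thesis using 1(2) splitI(2) by simp
  qed
qed

section \<open>Factorisation of matrices that are lower unitriangular modulo
  \<open>M\<close>\<close>

lemma addrow_lower:
  assumes "j < i" "i < n" "u \<in> R"
  shows "addrow_mat n u i j \<in> lower"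
  using assms
proof (induction i arbitrary: u)
  case (Suc m)
  show ?case
  proof (cases "m = j")
    case True
    thus ?thesis using Suc.prems by (simp add: low_lower)
  next
    case False
    hence jm: "j < m" "m < n" using Suc.prems by auto
    \<comment> \<open>The Steinberg relation: the commutator of transvections at
      \<open>(Suc m, m)\<close> and \<open>(m, j)\<close> is the one at
      \<open>(Suc m, j)\<close>.\<close>
    have "low u m * (addrow_mat n 1 m j * (low (- u) m * addrow_mat n (- 1) m j)) =
        addrow u (Suc m) m (addrow 1 m j (addrow (- u) (Suc m) m (addrow_mat n (- 1) m j)))"
      using jm Suc.prems by (simp add: addrow_mat[of _ n n, symmetric])
    also have "\<dots> = addrow_mat n u (Suc m) j"
      using jm Suc.prems by (intro eq_matI) auto
    finally have "addrow_mat n u (Suc m) j =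
      low u m * (addrow_mat n 1 m j * (low (- u) m * addrow_mat n (- 1) m j))" ..
    also have "\<dots> \<in> lower"
      using jm Suc.prems by (intro lower_mult low_lower Suc.IH R_minus R_1) auto
    finally show ?thesis .
  qed
qed simp

text \<open>The analogue of the pro-unipotent part of an Iwahori subgroup, with the lower triangle
  as the part that survives modulo \<open>M\<close>.\<close>

definition iwahori :: "'q mat set" where
  "iwahori = {A \<in> SL n. \<forall>i<n. A $$ (i, i) - 1 \<in> M \<and>
     (\<forall>j<n. (i < j \<longrightarrow> A $$ (i, j) \<in> M) \<and> (j < i \<longrightarrow> A $$ (i, j) \<in> R))}"

text \<open>Gaussian elimination clears the entries below the diagonal in the order of the codes
  \<open>s * n + r\<close> of the positions \<open>(r, s)\<close>, that is, column by column.\<close>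

lemma iwahori_cleared:
  assumes "A \<in> iwahori" "\<And>r s. s < r \<Longrightarrow> r < n \<Longrightarrow> s * n + r < m \<Longrightarrow> A $$ (r, s) = 0"
  shows "\<exists>L\<in>lower. \<exists>B\<in>borel. A = L * B"
  using assms
proof (induction "n * n - m" arbitrary: m A)
  case 0
  have A: "A \<in> SL n" using 0 by (simp add: iwahori_def)
  have "s * n + r < m" if "s < r" "r < n" for r s
  proof -
    have "s * n + r < Suc s * n" using that by simp
    also have "\<dots> \<le> n * n" using that by (intro mult_le_mono1) auto
    finally show ?thesis using 0 by simp
  qed
  hence "upper_tri n A" using 0 by (simp add: upper_tri_def)
  hence "A \<in> borel" using 0 by (simp add: borel_def iwahori_def)
  moreover have "A = 1\<^sub>m n * A" using A by (auto intro!: left_mult_one_mat[of _ n, symmetric])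
  ultimately show ?case using lower.one by blast
next
  case (Suc d)
  have A: "A \<in> SL n" using Suc by (simp add: iwahori_def)
  have cA: "A \<in> carrier_mat n n" using A by simp
  define s r where "s = m div n" and "r = m mod n"
  have m: "s * n + r = m" by (simp add: s_def r_def)
  have "m < n * n" using Suc.hyps(2) by simp
  hence n: "n > 0" by (cases n) auto
  hence r: "r < n" by (simp add: r_def)
  have pos: "s' = s \<and> r' = r" if "s' * n + r' = m" "r' < n" for s' r'
    using that unfolding s_def r_def by (metis add.commute div_mult_self1 div_less mod_less
        mod_mult_self1 n add_0 not_less0)
  show ?case
  proof (cases "s < r")
    case False
    show ?thesis
    proof (rule Suc.hyps(1)[of "Suc m"])
      show "d = n * n - Suc m" using Suc.hyps(2) by simp
      fix r' s' assume rs: "s' < r'" "r' < n" "s' * n + r' < Suc m"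
      hence "s' * n + r' \<noteq> m" using pos[of s' r'] False by auto
      thus "A $$ (r', s') = 0" using rs by (intro Suc.prems) auto
    qed (rule Suc.prems)
  next
    case True
    \<comment> \<open>The pivot lies in \<open>1 + M\<close>, so the multiplier stays in
      \<open>R\<close> and the row operation preserves \<open>iwahori\<close>.\<close>
    define u where "u = A $$ (r, s) / A $$ (s, s)"
    have ss: "A $$ (s, s) - 1 \<in> M" using Suc.prems(1) True r by (simp add: iwahori_def)
    have nz: "A $$ (s, s) \<noteq> 0" and inv: "inverse (A $$ (s, s)) - 1 \<in> M"
      using unit[OF ss] by auto
    have u: "u \<in> R" unfolding u_def divide_inverse
      using Suc.prems(1) True r one_unit_R[OF inv] by (auto simp: iwahori_def intro!: R_mult)
    define A' where "A' = addrow_mat n (- u) r s * A"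
    have A'_addrow: "A' = addrow (- u) r s A"
      unfolding A'_def using addrow_mat[OF cA] True r by simp
    have ent: "A' $$ (i, j) = (if i = r then A $$ (i, j) - u * A $$ (s, j) else A $$ (i, j))"
      if "i < n" "j < n" for i j
      unfolding A'_addrow using that cA by auto
    have A': "A' \<in> SL n" unfolding A'_def using True by (intro SL_mult addrow_mat_SL A) auto
    have iw: "A' \<in> iwahori"
    proof -
      have "A' $$ (i, i) - 1 \<in> M" if i: "i < n" for i
      proof (cases "i = r")
        case True
        have "u * A $$ (s, r) \<in> M"
          using Suc.prems(1) \<open>s < r\<close> r by (intro M_mult u) (auto simp: iwahori_def)
        hence "A $$ (r, r) + - (u * A $$ (s, r)) - 1 \<in> M"
          using Suc.prems(1) r by (intro one_unit_add M_minus) (auto simp: iwahori_def)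
        thus ?thesis using True i by (simp add: ent)
      qed (use i Suc.prems(1) in \<open>auto simp: ent iwahori_def\<close>)
      moreover have "A' $$ (i, j) \<in> M" if ij: "i < j" "j < n" for i j
      proof (cases "i = r")
        case True
        have "A $$ (r, j) - u * A $$ (s, j) \<in> M"
          using Suc.prems(1) \<open>s < r\<close> r ij True by (intro M_diff M_mult u) (auto simp: iwahori_def)
        thus ?thesis using True ij by (simp add: ent)
      qed (use ij Suc.prems(1) in \<open>auto simp: ent iwahori_def\<close>)
      moreover have "A' $$ (i, j) \<in> R" if ij: "j < i" "i < n" for i j
      proof (cases "i = r")
        case True
        have "A $$ (s, j) \<in> R"
          using Suc.prems(1) \<open>s < r\<close> r ij ss
          by (cases s j rule: linorder_cases) (auto simp: iwahori_def M_R one_unit_R)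
        hence "A $$ (r, j) + - (u * A $$ (s, j)) \<in> R"
          using Suc.prems(1) ij True by (intro R_add R_minus R_mult u) (auto simp: iwahori_def)
        thus ?thesis using True ij by (simp add: ent)
      qed (use ij Suc.prems(1) in \<open>auto simp: ent iwahori_def\<close>)
      ultimately show ?thesis using A' by (simp add: iwahori_def)
    qed
    have "\<exists>L\<in>lower. \<exists>B\<in>borel. A' = L * B"
    proof (rule Suc.hyps(1)[of "Suc m", OF _ iw])
      show "d = n * n - Suc m" using Suc.hyps(2) by simp
      fix r' s' assume rs: "s' < r'" "r' < n" "s' * n + r' < Suc m"
      show "A' $$ (r', s') = 0"
      proof (cases "s' * n + r' = m")
        case True
        thus ?thesis using pos[of s' r'] rs nz by (simp add: ent u_def)
      next
        case False
        hence lt: "s' * n + r' < m" using rs by simp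
        have z: "A $$ (r', s') = 0" using rs lt by (intro Suc.prems) auto
        show ?thesis
        proof (cases "r' = r")
          case True
          \<comment> \<open>Entries of row \<open>r\<close> in earlier columns stay zero because row
            \<open>s\<close>, which is subtracted, was cleared in those columns too.\<close>
          have "s' * n < s * n" using lt m True by linarith
          hence "s' < s" by (rule mult_less_cancel2[THEN iffD1, THEN conjunct2])
          moreover have "s' * n + s < m" using lt m \<open>s < r\<close> True by linarith
          ultimately have "A $$ (s, s') = 0" using \<open>s < r\<close> r by (intro Suc.prems) auto
          thus ?thesis using z rs True by (simp add: ent)
        qed (use z rs in \<open>simp add: ent\<close>)
      qed
    qed
    then obtain L B where LB: "L \<in> lower" "B \<in> borel" "A' = L * B" by blast
    have e: "addrow_mat n u r s \<in> lower" using True r u by (intro addrow_lower)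
    have "A = (addrow_mat n u r s * addrow_mat n (- u) r s) * A"
      using addrow_mat_inv[of r n s u] True r cA by simp
    also have "\<dots> = addrow_mat n u r s * A'"
      unfolding A'_def using True by (intro SL_mult_assoc[of _ n] addrow_mat_SL A) auto
    also have "\<dots> = (addrow_mat n u r s * L) * B"
      unfolding LB(3) using lower_SL[OF LB(1)] lower_SL[OF e] borel_D(1)[OF LB(2)]
      by (intro SL_mult_assoc[symmetric, of _ n]) auto
    finally show ?thesis using lower_mult[OF LB(1) e] LB(2) by blast
  qed
qed

theorem iwahori_split:
  assumes "A \<in> iwahori"
  shows "\<exists>x. split A x"
  using iwahori_cleared[OF assms, of 0] splitI by fastforce

end

section \<open>Laurent series at infinity\<close>

text \<open>Loosening the summation range lets the three products in the Leibniz rule be expanded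
  over the same indices.\<close>

lemma fls_times_nth_bounds:
  fixes f g :: "'a::comm_ring_1 fls"
  assumes "a \<le> fls_subdegree f" "b \<le> fls_subdegree g"
  shows "fls_nth (f * g) k = (\<Sum>i = a..k - b. fls_nth f i * fls_nth g (k - i))"
proof -
  have "fls_nth (f * g) k = (\<Sum>i = fls_subdegree f..k - fls_subdegree g. fls_nth f i * fls_nth g (k - i))"
    by (rule fls_times_nth(2))
  also have "\<dots> = (\<Sum>i = a..k - b. fls_nth f i * fls_nth g (k - i))"
  proof (intro sum.mono_neutral_left ballI)
    fix i assume "i \<in> {a..k - b} - {fls_subdegree f..k - fls_subdegree g}"
    hence "i < fls_subdegree f \<or> k - i < fls_subdegree g" by auto
    thus "fls_nth f i * fls_nth g (k - i) = 0" by auto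
  qed (use assms in auto)
  finally show ?thesis .
qed

definition fls_coeff_derivation :: "('a::comm_ring_1 \<Rightarrow> 'a) \<Rightarrow> 'a fls \<Rightarrow> 'a fls" where
  "fls_coeff_derivation d f = Abs_fls (\<lambda>i. d (fls_nth f i))"

lemma fls_coeff_derivation_nth:
  assumes "derivation d"
  shows "fls_nth (fls_coeff_derivation d f) i = d (fls_nth f i)"
  unfolding fls_coeff_derivation_def
  by (rule nth_Abs_fls_lower_bound[where N = "fls_subdegree f"]) (simp add: derivation_0[OF assms])

lemma fls_coeff_derivation_subdegree:
  assumes "derivation d" "fls_coeff_derivation d f \<noteq> 0"
  shows "fls_subdegree f \<le> fls_subdegree (fls_coeff_derivation d f)"
  using assms(2)
  by (rule fls_subdegree_geI) (simp add: fls_coeff_derivation_nth[OF assms(1)] derivation_0[OF assms(1)])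

lemma fls_coeff_derivation_subdegree_ge:
  assumes "derivation d"
  shows "min 0 (fls_subdegree f) \<le> fls_subdegree (fls_coeff_derivation d f)"
  using fls_coeff_derivation_subdegree[OF assms, of f] by (cases "fls_coeff_derivation d f = 0") auto

lemma derivation_fls_coeff_derivation:
  assumes d: "derivation d"
  shows "derivation (fls_coeff_derivation d)"
  unfolding derivation_def
proof (intro conjI allI fls_eqI)
  note nth = fls_coeff_derivation_nth[OF d]
  fix f g k
  show "fls_nth (fls_coeff_derivation d (f + g)) k = fls_nth (fls_coeff_derivation d f + fls_coeff_derivation d g) k"
    by (simp add: nth derivation_add[OF d])
  let ?a = "min 0 (fls_subdegree f)" and ?b = "min 0 (fls_subdegree g)"
  have "fls_nth (fls_coeff_derivation d (f * g)) k = d (\<Sum>i = ?a..k - ?b. fls_nth f i * fls_nth g (k - i))"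
    unfolding nth by (subst fls_times_nth_bounds[of ?a f ?b g]) auto
  also have "\<dots> = (\<Sum>i = ?a..k - ?b. fls_nth f i * fls_nth (fls_coeff_derivation d g) (k - i)) +
      (\<Sum>i = ?a..k - ?b. fls_nth (fls_coeff_derivation d f) i * fls_nth g (k - i))"
    by (simp add: derivation_sum[OF d] derivation_mult[OF d] nth sum.distrib)
  also have "\<dots> = fls_nth (f * fls_coeff_derivation d g + fls_coeff_derivation d f * g) k"
    using fls_times_nth_bounds[of ?a f ?b "fls_coeff_derivation d g" k]
      fls_times_nth_bounds[of ?a "fls_coeff_derivation d f" ?b g k] fls_coeff_derivation_subdegree_ge[OF d]
    by simp
  finally show "fls_nth (fls_coeff_derivation d (f * g)) k =
      fls_nth (f * fls_coeff_derivation d g + fls_coeff_derivation d f * g) k" .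
qed

text \<open>With \<open>X = 1 / t\<close>, this is the derivation \<open>d/dt\<close>.\<close>

definition fls_deriv_inv :: "'a::comm_ring_1 fls \<Rightarrow> 'a fls" where
  "fls_deriv_inv f = - (fls_X ^ 2 * fls_deriv f)"

lemma derivation_fls_deriv_inv: "derivation (fls_deriv_inv :: 'a::comm_ring_1 fls \<Rightarrow> _)"
  by (simp add: derivation_def fls_deriv_inv_def algebra_simps)

text \<open>In powers of \<open>X = 1 / t\<close>, applying \<open>d\<close> to coefficients does
  not lower the order, so the first factor has order at least 0. Differentiating in \<open>X\<close>
  lowers it by at most 1 and \<open>X ^ 2\<close> raises it by 2, so the second has order at least
  1. The product has no constant term.\<close>

lemma fls_dlog_mult_dlog_nth_0:
  fixes a b :: "'a::field fls"
  assumes d: "derivation d"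
  shows "fls_nth (fls_coeff_derivation d a / a * (fls_deriv_inv b / b)) 0 = 0"
\<comment> \<open>Zero series are treated apart, since their subdegree is 0 by convention and the
  order estimate fails.\<close>
proof (cases "fls_coeff_derivation d a = 0 \<or> fls_deriv b = 0 \<or> a = 0 \<or> b = 0")
  case True
  thus ?thesis by (auto simp: fls_deriv_inv_def)
next
  case False
  have a: "fls_subdegree a \<le> fls_subdegree (fls_coeff_derivation d a)"
    using False by (intro fls_coeff_derivation_subdegree[OF d]) auto
  have b: "fls_subdegree b - 1 \<le> fls_subdegree (fls_deriv b)"
    using False by (intro fls_subdegree_geI) auto
  have "fls_subdegree (fls_coeff_derivation d a / a * (fls_deriv_inv b / b)) > 0"
    using False a b by (simp add: fls_deriv_inv_def fls_divide_subdegree fls_subdegree_mult fls_subdegree_pow)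
  thus ?thesis by simp
qed

section \<open>Expansion of polynomials at infinity\<close>

definition at_inf :: "'a::comm_ring_1 poly \<Rightarrow> 'a fls" where
  "at_inf p = fold_coeffs (\<lambda>a f. fls_const a + fls_X_inv * f) p 0"

lemma at_inf_0 [simp]: "at_inf 0 = 0"
  by (simp add: at_inf_def)

lemma at_inf_pCons [simp]: "at_inf (pCons a p) = fls_const a + fls_X_inv * at_inf p"
  by (cases "p = 0 \<and> a = 0") (auto simp: at_inf_def)

lemma at_inf_nth: "fls_nth (at_inf p) k = (if k \<le> 0 then coeff p (nat (- k)) else 0)"
proof (induction p arbitrary: k)
  case (pCons a p)
  show ?case
    by (cases "k = 0") (auto simp: fls_X_inv_times_conv_shift pCons.IH coeff_pCons split: nat.splits
        intro!: arg_cong[of _ _ "coeff p"])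
qed simp

lemma at_inf_add: "at_inf (p + q) = at_inf p + at_inf q"
  by (rule fls_eqI) (simp add: at_inf_nth)

lemma at_inf_smult: "at_inf (smult a p) = fls_const a * at_inf p"
  by (rule fls_eqI) (simp add: at_inf_nth)

lemma at_inf_mult: "at_inf (p * q) = at_inf p * at_inf q"
  by (induction p) (simp_all add: at_inf_add at_inf_smult algebra_simps)

lemma at_inf_1: "at_inf 1 = 1"
  by (simp add: one_pCons)

interpretation at_inf: comm_ring_hom at_inf
  by unfold_locales (simp_all add: at_inf_add at_inf_mult at_inf_1)

lemma at_inf_eq_0_iff: "at_inf p = 0 \<longleftrightarrow> p = 0"
proof
  assume "at_inf p = 0"
  hence "coeff p k = 0" for k using at_inf_nth[of p "- int k"] by simp
  thus "p = 0" by (simp add: poly_eq_iff)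
qed simp

lemma fls_coeff_derivation_at_inf:
  assumes "derivation d"
  shows "fls_coeff_derivation d (at_inf p) = at_inf (map_poly d p)"
  by (rule fls_eqI)
    (simp add: fls_coeff_derivation_nth[OF assms] at_inf_nth coeff_map_poly derivation_0[OF assms])

lemma fls_deriv_inv_X_inv: "fls_deriv_inv (fls_X_inv :: 'a::field fls) = 1"
proof -
  have "(fls_X :: 'a fls) * fls_X_inv = 1" by (rule fls_eqI) (simp add: fls_X_times_conv_shift)
  hence "((fls_X :: 'a fls) * fls_X_inv) ^ 2 = 1" by simp
  thus ?thesis by (simp add: fls_deriv_inv_def power_mult_distrib)
qed

lemma fls_deriv_inv_at_inf:
  fixes p :: "'a::field poly"
  shows "fls_deriv_inv (at_inf p) = at_inf (pderiv p)"
proof (induction p)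
  case 0
  show ?case by (simp add: fls_deriv_inv_def)
next
  case (pCons a p)
  have "fls_deriv_inv (fls_const a) = 0" by (simp add: fls_deriv_inv_def)
  thus ?case
    using pCons by (simp add: derivation_add[OF derivation_fls_deriv_inv]
        derivation_mult[OF derivation_fls_deriv_inv] fls_deriv_inv_X_inv pderiv_pCons at_inf_add)
qed

section \<open>The local ring at \<open>t = 0\<close> inside the Laurent series\<close>

definition regular_at_0 :: "'a::field fls set" where
  "regular_at_0 = {f. \<exists>p q. coeff q 0 = 1 \<and> f * at_inf q = at_inf p}"

definition zero_at_0 :: "'a::field fls set" where
  "zero_at_0 = {f. \<exists>p q. coeff q 0 = 1 \<and> coeff p 0 = 0 \<and> f * at_inf q = at_inf p}"

lemma at_inf_regular: "at_inf p \<in> regular_at_0"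
  unfolding regular_at_0_def by (rule CollectI, rule exI[of _ p], rule exI[of _ 1]) (simp add: at_inf_1)

lemma at_inf_zero_at_0: "coeff p 0 = 0 \<Longrightarrow> at_inf p \<in> zero_at_0"
  unfolding zero_at_0_def by (rule CollectI, rule exI[of _ p], rule exI[of _ 1]) (simp add: at_inf_1)

lemma dlog_pairing_fls:
  fixes d :: "'a::field \<Rightarrow> 'a"
  assumes d: "derivation d"
  shows "dlog_pairing (fls_coeff_derivation d) fls_deriv_inv (\<lambda>f. fls_nth f 0)
    regular_at_0 (zero_at_0 :: 'a fls set)"
proof
  show "derivation (fls_coeff_derivation d)" "derivation (fls_deriv_inv :: 'a fls \<Rightarrow> _)"
    by (rule derivation_fls_coeff_derivation[OF d] derivation_fls_deriv_inv)+
  fix a b :: "'a fls"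
  show "fls_nth (fls_coeff_derivation d a / a * (fls_deriv_inv b / b)) 0 = 0"
    by (rule fls_dlog_mult_dlog_nth_0[OF d])
next
  show "1 \<in> (regular_at_0 :: 'a fls set)" "0 \<in> (zero_at_0 :: 'a fls set)"
    using at_inf_regular[of "1 :: 'a poly"] at_inf_zero_at_0[of "0 :: 'a poly"]
    by (simp_all add: at_inf_1)
next
  fix x y :: "'a fls"
  show "x \<in> zero_at_0 \<Longrightarrow> x \<in> regular_at_0"
    by (auto simp: zero_at_0_def regular_at_0_def)
  have minus: "- x * at_inf q = at_inf (- p)" if "x * at_inf q = at_inf p" for p q
    using that by (simp add: at_inf.hom_uminus)
  show "x \<in> regular_at_0 \<Longrightarrow> - x \<in> regular_at_0"
    unfolding regular_at_0_def using minus by blast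
  have mult: "x * y * at_inf (q * q') = at_inf (p * p')"
    "(x + y) * at_inf (q * q') = at_inf (p * q' + p' * q)" "coeff (q * q') 0 = 1"
    if "x * at_inf q = at_inf p" "y * at_inf q' = at_inf p'" "coeff q 0 = 1" "coeff q' 0 = 1" for p q p' q'
    using that(3,4) by (simp_all add: at_inf_add at_inf_mult that(1,2)[symmetric] coeff_mult_0 algebra_simps)
  show "x \<in> regular_at_0 \<Longrightarrow> y \<in> regular_at_0 \<Longrightarrow> x * y \<in> regular_at_0"
    unfolding regular_at_0_def using mult(1,3) by blast
  show "x \<in> regular_at_0 \<Longrightarrow> y \<in> regular_at_0 \<Longrightarrow> x + y \<in> regular_at_0"
    unfolding regular_at_0_def using mult(2,3) by blast
  show "x \<in> zero_at_0 \<Longrightarrow> y \<in> zero_at_0 \<Longrightarrow> x + y \<in> zero_at_0"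
  proof -
    assume "x \<in> zero_at_0" "y \<in> zero_at_0"
    then obtain p q p' q' where "x * at_inf q = at_inf p" "y * at_inf q' = at_inf p'"
      "coeff q 0 = 1" "coeff q' 0 = 1" "coeff p 0 = 0" "coeff p' 0 = 0"
      by (auto simp: zero_at_0_def)
    moreover from this have "coeff (p * q' + p' * q) 0 = 0" by (simp add: coeff_mult_0)
    ultimately show ?thesis unfolding zero_at_0_def using mult(2,3) by blast
  qed
  show "x \<in> regular_at_0 \<Longrightarrow> y \<in> zero_at_0 \<Longrightarrow> x * y \<in> zero_at_0"
  proof -
    assume "x \<in> regular_at_0" "y \<in> zero_at_0"
    then obtain p q p' q' where "x * at_inf q = at_inf p" "y * at_inf q' = at_inf p'"
      "coeff q 0 = 1" "coeff q' 0 = 1" "coeff p' 0 = 0"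
      by (auto simp: zero_at_0_def regular_at_0_def)
    moreover from this have "coeff (p * p') 0 = 0" by (simp add: coeff_mult_0)
    ultimately show ?thesis unfolding zero_at_0_def using mult(1,3) by blast
  qed
  show "x - 1 \<in> zero_at_0 \<Longrightarrow> x \<noteq> 0 \<and> inverse x - 1 \<in> zero_at_0"
  proof -
    assume "x - 1 \<in> zero_at_0"
    then obtain p q where pq: "coeff q 0 = 1" "coeff p 0 = 0" "(x - 1) * at_inf q = at_inf p"
      by (auto simp: zero_at_0_def)
    \<comment> \<open>Here \<open>x\<close> is the fraction with numerator \<open>p + q\<close> and
      denominator \<open>q\<close>, so \<open>p + q\<close> becomes the denominator of the inverse
      and is still normalised; \<open>inverse x - 1\<close> has numerator
      \<open>- p\<close>.\<close>
    have c: "coeff (p + q) 0 = 1" using pq by simp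
    hence "p + q \<noteq> 0" by (metis coeff_0 zero_neq_one)
    moreover have x: "x * at_inf q = at_inf (p + q)" using pq(3) by (simp add: at_inf_add algebra_simps)
    ultimately have "x \<noteq> 0" by (metis at_inf_eq_0_iff mult_zero_left)
    moreover have "(inverse x - 1) * at_inf (p + q) = at_inf (- p)"
      unfolding x[symmetric] using \<open>x \<noteq> 0\<close> pq(3)
      by (simp add: at_inf.hom_uminus pq(3)[symmetric] algebra_simps)
    hence "inverse x - 1 \<in> zero_at_0"
      unfolding zero_at_0_def using c pq(2) by (intro CollectI exI[of _ "- p"] exI[of _ "p + q"]) auto
    ultimately show ?thesis by blast
  qed
qed simp

section \<open>The homomorphism on the congruence subgroup\<close>

lemma t_power_one_dvd_iff: "[:0, 1:] ^ 1 dvd p \<longleftrightarrow> coeff p 0 = (0 :: 'a::field)"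
  using poly_eq_0_iff_dvd[of p 0] by (simp add: poly_0_coeff_0)

section \<open>Two-by-two blocks and congruences\<close>

definition block2 :: "nat \<Rightarrow> 'a::comm_ring_1 \<Rightarrow> 'a \<Rightarrow> 'a \<Rightarrow> 'a \<Rightarrow> 'a mat" where
  "block2 n a b c d = mat n n (\<lambda>(i, j).
     if i = 0 \<and> j = 0 then a else if i = 0 \<and> j = 1 then b
     else if i = 1 \<and> j = 0 then c else if i = 1 \<and> j = 1 then d
     else if i = j then 1 else 0)"

lemma block2_mult:
  assumes n: "n \<ge> 2"
  shows "block2 n a b c d * block2 n a' b' c' d' =
    block2 n (a * a' + b * c') (a * b' + b * d') (c * a' + d * c') (c * b' + d * d')"
    (is "?A * ?B = ?C")
proof (rule eq_matI)
  fix i j assume "i < dim_row ?C" "j < dim_col ?C"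
  hence ij: "i < n" "j < n" by (simp_all add: block2_def)
  \<comment> \<open>The only columns in which row \<open>i\<close> of a block matrix can be
    nonzero.\<close>
  define S where "S = (if i < 2 then {0, 1} else {i})"
  have "(?A * ?B) $$ (i, j) = (\<Sum>k<n. ?A $$ (i, k) * ?B $$ (k, j))"
    using ij by (intro mult_index) (simp_all add: block2_def)
  also have "\<dots> = (\<Sum>k\<in>S. ?A $$ (i, k) * ?B $$ (k, j))"
    using n ij by (intro sum_lessThan_eq_subset) (auto simp: block2_def S_def split: if_splits)
  also have "\<dots> = ?C $$ (i, j)"
    using n ij by (cases "i = 0"; cases "i = 1") (auto simp: block2_def S_def)
  finally show "(?A * ?B) $$ (i, j) = ?C $$ (i, j)" .
qed (simp_all add: block2_def)

lemma addrow_mat_block2: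
  assumes "n \<ge> 2"
  shows "addrow_mat n p 0 1 = block2 n 1 p 0 1" "addrow_mat n p 1 0 = block2 n 1 0 p 1"
  using assms by (auto simp: block2_def intro!: eq_matI)

lemma block2_congruence_subgroup:
  assumes "n \<ge> 2" "block2 n a b c d \<in> SL n" "[:0, 1:] ^ i dvd a - 1" "[:0, 1:] ^ i dvd b"
    "[:0, 1:] ^ i dvd c" "[:0, 1:] ^ i dvd d - 1"
  shows "block2 n a b c d \<in> congruence_subgroup n i"
  using assms unfolding congruence_subgroup_def by (auto simp: block2_def)

text \<open>Since \<open>t\<close> divides \<open>1 - a\<close>, the geometric series in
  \<open>1 - a\<close>, cut off after \<open>l\<close> terms, inverts \<open>a\<close> modulo
  \<open>t ^ l\<close>.\<close>

lemma inverse_mod_t_power: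
  fixes a :: "'a::field poly"
  assumes "coeff a 0 = 1"
  shows "\<exists>s. [:0, 1:] ^ l dvd a * s - 1"
proof -
  have "[:0, 1:] dvd 1 - a" using t_power_one_dvd_iff[of "1 - a"] assms by simp
  hence "[:0, 1:] ^ l dvd (1 - a) ^ l" by (rule dvd_power_same)
  moreover have "a * (\<Sum>i<l. (1 - a) ^ i) = 1 - (1 - a) ^ l"
    using one_diff_power_eq[of "1 - a" l] by simp
  hence "a * (\<Sum>i<l. (1 - a) ^ i) - 1 = - ((1 - a) ^ l)" by simp
  ultimately have "[:0, 1:] ^ l dvd a * (\<Sum>i<l. (1 - a) ^ i) - 1" by (simp only: dvd_minus_iff)
  thus ?thesis by blast
qed

text \<open>The conclusions concern the four entries of \<open>k h^-1\<close> for blocks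
  \<open>k\<close> and \<open>h\<close> of determinant one with the same upper left entry
  \<open>a\<close>. As \<open>a\<close> is invertible modulo \<open>T\<close>, agreement off the
  diagonal forces agreement of the last entry through the determinant.\<close>

lemma congruence_of_block2:
  fixes k12 k21 k22 h12 h21 h22 a s T :: "'a::comm_ring_1"
  assumes s: "T dvd a * s - 1" and k: "a * k22 - k12 * k21 = 1" and h: "a * h22 - h12 * h21 = 1"
    and 12: "T dvd h12 - k12" and 21: "T dvd h21 - k21"
  shows "T dvd (a * h22 - k12 * h21) - 1" "T dvd k12 * a - a * h12" "T dvd k21 * h22 - k22 * h21"
    "T dvd (k22 * a - k21 * h12) - 1"
proof -
  have "a * h22 - k12 * h21 - 1 = (h12 - k12) * h21" using h by (simp add: algebra_simps)
  thus "T dvd (a * h22 - k12 * h21) - 1" using 12 by simp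
  have "k12 * a - a * h12 = - (a * (h12 - k12))" by (simp add: algebra_simps)
  thus "T dvd k12 * a - a * h12" using 12 by simp
  have "k22 * a - k21 * h12 - 1 = - (k21 * (h12 - k12))" using k by (simp add: algebra_simps)
  thus "T dvd (k22 * a - k21 * h12) - 1" using 12 by simp
  have "a * (h22 - k22) = h12 * (h21 - k21) + k21 * (h12 - k12)" using k h by (simp add: algebra_simps)
  hence a: "T dvd a * (h22 - k22)" using 12 21 by simp
  have "h22 - k22 = s * (a * (h22 - k22)) - (a * s - 1) * (h22 - k22)" by (simp add: algebra_simps)
  hence 22: "T dvd h22 - k22" using a s by (metis dvd_diff dvd_mult dvd_mult2)
  have "k21 * h22 - k22 * h21 = k21 * (h22 - k22) - k22 * (h21 - k21)" by (simp add: algebra_simps)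
  thus "T dvd k21 * h22 - k22 * h21" using 22 21 by simp
qed

abbreviation at_inf_mat :: "'a::field poly mat \<Rightarrow> 'a fls mat" where
  "at_inf_mat \<equiv> map_mat at_inf"

lemma at_inf_mat_mult:
  "A \<in> carrier_mat n n \<Longrightarrow> B \<in> carrier_mat n n \<Longrightarrow> at_inf_mat (A * B) = at_inf_mat A * at_inf_mat B"
  by (rule at_inf.mat_hom_mult)

lemma at_inf_mat_SL: "A \<in> SL n \<Longrightarrow> at_inf_mat A \<in> SL n"
  by (simp add: at_inf_1)

lemma adj_at_inf_mat:
  assumes "A \<in> SL n"
  shows "adj_mat (at_inf_mat A) = at_inf_mat (adj_mat A)"
proof (rule SL_mult_left_cancel[OF at_inf_mat_SL[OF assms]])
  note a = SL_D[OF assms] and b = SL_D[OF at_inf_mat_SL[OF assms]]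
  show "at_inf_mat A * adj_mat (at_inf_mat A) = at_inf_mat A * at_inf_mat (adj_mat A)"
    unfolding b(4) at_inf_mat_mult[OF a(1,3), symmetric] a(4) by (simp add: at_inf.mat_hom_one)
qed (use SL_D(3)[OF assms] SL_D(3)[OF at_inf_mat_SL[OF assms]] in auto)

lemma at_inf_addrow_mat: "at_inf_mat (addrow_mat n p i j) = addrow_mat n (at_inf p) i j"
  by (rule eq_matI) (auto simp: at_inf_1 at_inf_add)

lemma congruence_subgroup_SL: "A \<in> congruence_subgroup n i \<Longrightarrow> A \<in> SL n"
  by (simp add: congruence_subgroup_def)

lemma congruence_subgroup_1_coeff:
  assumes "A \<in> congruence_subgroup n 1" "i < n" "j < n"
  shows "coeff (A $$ (i, j)) 0 = (if i = j then 1 else 0)"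
proof -
  have "[:0, 1:] ^ 1 dvd A $$ (i, j) - 1\<^sub>m n $$ (i, j)"
    using assms unfolding congruence_subgroup_def by blast
  thus ?thesis using assms(2,3) unfolding t_power_one_dvd_iff by (auto split: if_splits)
qed

lemma congruence_subgroup_1I:
  assumes "A \<in> SL n" "\<And>i j. i < n \<Longrightarrow> j < n \<Longrightarrow> coeff (A $$ (i, j)) 0 = (if i = j then 1 else 0)"
  shows "A \<in> congruence_subgroup n 1"
  unfolding congruence_subgroup_def t_power_one_dvd_iff using assms by auto

section \<open>Comparison of the two splittings on the congruence subgroup\<close>

context
  fixes d :: "'a::field \<Rightarrow> 'a" and n :: nat
  assumes d: "derivation d"
begin

interpretation P: dlog_pairing "fls_coeff_derivation d" fls_deriv_inv "\<lambda>f. fls_nth f 0"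
  regular_at_0 zero_at_0 n
  by (rule dlog_pairing_fls[OF d])

text \<open>Both logarithmic derivatives are polynomial matrices, so the residue is the constant
  term of a trace. Modulo \<open>t\<close> the matrix \<open>g\<close> is the identity, whose
  entries \<open>d\<close> kills; hence every entry of the left factor is divisible by
  \<open>t\<close>.\<close>

lemma coc_congruence_subgroup:
  assumes g: "g \<in> congruence_subgroup n 1" and h: "h \<in> SL n"
  shows "P.coc (at_inf_mat g) (at_inf_mat h) = 0"
proof -
  have gS: "g \<in> SL n" by (rule congruence_subgroup_SL[OF g])
  note g' = SL_D[OF gS] and h' = SL_D[OF h]
  define A B where "A = map_mat (map_poly d) g" and "B = map_mat pderiv h"
  have AB: "A \<in> carrier_mat n n" "B \<in> carrier_mat n n" using g' h' by (auto simp: A_def B_def)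
  have "ldlog (fls_coeff_derivation d) (at_inf_mat g) = at_inf_mat (adj_mat g * A)"
  proof -
    have "map_mat (fls_coeff_derivation d) (at_inf_mat g) = at_inf_mat A"
      by (rule eq_matI) (auto simp: A_def fls_coeff_derivation_at_inf[OF d])
    thus ?thesis unfolding ldlog_def adj_at_inf_mat[OF gS] at_inf_mat_mult[OF g'(3) AB(1)] by simp
  qed
  moreover have "rdlog fls_deriv_inv (at_inf_mat h) = at_inf_mat (B * adj_mat h)"
  proof -
    have "map_mat fls_deriv_inv (at_inf_mat h) = at_inf_mat B"
      by (rule eq_matI) (auto simp: B_def fls_deriv_inv_at_inf)
    thus ?thesis unfolding rdlog_def adj_at_inf_mat[OF h] at_inf_mat_mult[OF AB(2) h'(3)] by simp
  qed
  ultimately have "dlog_cocycle (fls_coeff_derivation d) fls_deriv_inv (at_inf_mat g) (at_inf_mat h) =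
      mat_trace (at_inf_mat ((adj_mat g * A) * (B * adj_mat h)))"
    unfolding dlog_cocycle_def
    by (simp only: at_inf_mat_mult[OF mult_carrier_mat[OF g'(3) AB(1)] mult_carrier_mat[OF AB(2) h'(3)]])
  also have "fls_nth \<dots> 0 = 0"
  proof -
    have A0: "coeff (A $$ (i, j)) 0 = 0" if "i < n" "j < n" for i j
      using congruence_subgroup_1_coeff[OF g that] that g'(1)
      by (auto simp: A_def coeff_map_poly derivation_0[OF d] derivation_1[OF d] split: if_splits)
    have gA: "coeff ((adj_mat g * A) $$ (i, j)) 0 = 0" if "i < n" "j < n" for i j
      unfolding mult_index[OF g'(3) AB(1) that] using that by (simp add: coeff_sum coeff_mult_0 A0)
    have "coeff (((adj_mat g * A) * (B * adj_mat h)) $$ (i, i)) 0 = 0" if "i < n" for i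
      unfolding mult_index[OF mult_carrier_mat[OF g'(3) AB(1)] mult_carrier_mat[OF AB(2) h'(3)] that that]
      using gA[OF that] by (simp add: coeff_sum coeff_mult_0 del: index_mult_mat)
    moreover have "(adj_mat g * A) * (B * adj_mat h) \<in> carrier_mat n n"
      by (rule mult_carrier_mat[OF mult_carrier_mat[OF g'(3) AB(1)] mult_carrier_mat[OF AB(2) h'(3)]])
    ultimately show ?thesis
      by (simp add: mat_trace_def at_inf_nth fls_nth_sum del: index_mult_mat)
  qed
  finally show ?thesis unfolding P.coc_def .
qed

lemma congruence_subgroup_1_iwahori:
  assumes "g \<in> congruence_subgroup n 1"
  shows "at_inf_mat g \<in> P.iwahori"
proof -
  have g: "g \<in> SL n" by (rule congruence_subgroup_SL[OF assms])
  hence c: "g \<in> carrier_mat n n" by simp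
  have "at_inf (g $$ (i, j)) \<in> zero_at_0" if "i < n" "j < n" "i \<noteq> j" for i j
    using congruence_subgroup_1_coeff[OF assms that(1,2)] that by (intro at_inf_zero_at_0) simp
  moreover have "at_inf (g $$ (i, i)) - 1 \<in> zero_at_0" if "i < n" for i
  proof -
    have "at_inf (g $$ (i, i) - 1) \<in> zero_at_0"
      using congruence_subgroup_1_coeff[OF assms that that] by (intro at_inf_zero_at_0) simp
    thus ?thesis by (simp add: at_inf.hom_minus at_inf_1)
  qed
  ultimately show ?thesis
    using at_inf_mat_SL[OF g] c by (auto simp: P.iwahori_def at_inf_regular)
qed

definition dlog_hom :: "'a poly mat \<Rightarrow> 'a" where
  "dlog_hom g = (THE x. P.split (at_inf_mat g) x)"

lemma dlog_hom_eqI: "P.split (at_inf_mat g) x \<Longrightarrow> dlog_hom g = x"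
  unfolding dlog_hom_def by (rule the_equality) (auto intro: P.split_unique)

lemma split_dlog_hom: "g \<in> congruence_subgroup n 1 \<Longrightarrow> P.split (at_inf_mat g) (dlog_hom g)"
  using P.iwahori_split[OF congruence_subgroup_1_iwahori] dlog_hom_eqI by metis

text \<open>In \<open>split_mult\<close> the correction term is a cocycle value on the congruence
  subgroup and hence zero.\<close>

lemma dlog_hom_mult:
  assumes "g \<in> congruence_subgroup n 1" "h \<in> congruence_subgroup n 1"
  shows "dlog_hom (g * h) = dlog_hom g + dlog_hom h"
proof (rule dlog_hom_eqI)
  have g: "g \<in> SL n" and h: "h \<in> SL n" using assms by (auto dest: congruence_subgroup_SL)
  show "P.split (at_inf_mat (g * h)) (dlog_hom g + dlog_hom h)"
    using P.split_mult[OF split_dlog_hom[OF assms(1)] split_dlog_hom[OF assms(2)]]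
      coc_congruence_subgroup[OF assms(1) h] at_inf_mat_mult[of g n h] g h by auto
qed

lemma split_borel_0: "B \<in> P.borel \<Longrightarrow> P.split B 0"
proof -
  assume B: "B \<in> P.borel"
  have 1: "1\<^sub>m n \<in> P.borel" using P.M_0 by (auto simp: P.borel_def upper_tri_def)
  have "P.split (1\<^sub>m n * B) (P.coc (1\<^sub>m n) B)" by (rule P.splitI[OF P.lower.one B])
  thus ?thesis using P.coc_borel[OF 1 B] P.borel_D(1)[OF B]
    by (simp add: left_mult_one_mat[of _ n n])
qed

lemma split_lower_0:
  assumes L: "L \<in> P.lower" shows "P.split L 0"
proof -
  have 1: "1\<^sub>m n \<in> P.borel" using P.M_0 by (auto simp: P.borel_def upper_tri_def)
  have L': "L \<in> SL n" using P.lower_SL[OF L] by blast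
  have "P.split (1\<^sub>m n * L) (0 + P.coc (1\<^sub>m n) L)"
    by (rule P.split_lower[OF L split_borel_0[OF 1]])
  \<comment> \<open>The cocycle identity for the identity, the identity and \<open>L\<close> reduces
    this to the value on two identities.\<close>
  moreover have "P.coc (1\<^sub>m n) L = 0"
    using P.coc[OF P.borel_D(1)[OF 1] P.borel_D(1)[OF 1] L'] P.coc_borel[OF 1 1] L'
    by (simp add: left_mult_one_mat[of _ n n])
  ultimately show ?thesis using L' by (simp add: left_mult_one_mat[of _ n n])
qed

lemma dlog_hom_one: "dlog_hom (1\<^sub>m n) = 0"
proof (rule dlog_hom_eqI, rule split_borel_0)
  show "at_inf_mat (1\<^sub>m n) \<in> P.borel"
    using P.M_0 by (auto simp: P.borel_def upper_tri_def at_inf.mat_hom_one)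
qed

lemma split_upper_elementary:
  assumes n: "n \<ge> 2" and p: "coeff p 0 = 0"
  shows "P.split (at_inf_mat (addrow_mat n p 0 1)) 0"
proof (rule split_borel_0)
  have "at_inf_mat (addrow_mat n p 0 1) \<in> SL n" by (intro at_inf_mat_SL addrow_mat_SL) simp
  moreover have "at_inf p \<in> zero_at_0" by (rule at_inf_zero_at_0[OF p])
  ultimately show "at_inf_mat (addrow_mat n p 0 1) \<in> P.borel"
    unfolding at_inf_addrow_mat P.borel_def using n P.M_0 by (auto simp: upper_tri_def)
qed

lemma split_lower_elementary:
  assumes n: "n \<ge> 2"
  shows "P.split (at_inf_mat (addrow_mat n q 1 0)) 0"
  unfolding at_inf_addrow_mat
  using n by (intro split_lower_0 P.addrow_lower at_inf_regular) auto

lemma rdlog_upper_elementary: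
  assumes n: "n \<ge> 2"
  shows "rdlog fls_deriv_inv (at_inf_mat (addrow_mat n p 0 1)) = single_mat n 0 1 (at_inf (pderiv p))"
  unfolding at_inf_addrow_mat
  using n by (subst rdlog_addrow_mat[OF derivation_fls_deriv_inv]) (auto simp: fls_deriv_inv_at_inf)

text \<open>The three factors each lift with value 0, so only cocycle terms count. The first product
  contributes \<open>d u\<close> times the \<open>t\<close>-derivative \<open>c\<close> of
  \<open>c t\<close>; the last contributes nothing because its parameter is constant in
  \<open>t\<close>. The constant factors lie outside \<open>K\<close> when \<open>u\<close> is
  nonzero, so this value is visible only through the larger group.\<close>

lemma split_conjugate:
  assumes n: "n \<ge> 2"
  shows "P.split (at_inf_mat (addrow_mat n [:u:] 1 0 * addrow_mat n [:0, c:] 0 1 *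
    addrow_mat n [:- u:] 1 0)) (d u * c)"
proof -
  let ?L = "addrow_mat n [:u:] 1 0" and ?U = "addrow_mat n [:0, c:] 0 1"
    and ?L' = "addrow_mat n [:- u:] 1 0"
  have SL: "?L \<in> SL n" "?U \<in> SL n" "?L' \<in> SL n" by (intro addrow_mat_SL; simp)+
  note S = at_inf_mat_SL[OF SL(1)] at_inf_mat_SL[OF SL(2)] at_inf_mat_SL[OF SL(3)]
  have 1: "P.coc (at_inf_mat ?L) (at_inf_mat ?U) = d u * c"
  proof -
    have "at_inf_mat ?L = addrow_mat n (at_inf [:u:]) (Suc 0) 0"
      unfolding at_inf_addrow_mat by simp
    hence "P.coc (at_inf_mat ?L) (at_inf_mat ?U) =
        fls_nth (fls_coeff_derivation d (at_inf [:u:]) * rdlog fls_deriv_inv (at_inf_mat ?U) $$ (0, Suc 0)) 0"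
      using P.coc_low_left[OF S(2), of 0 "at_inf [:u:]"] n by simp
    also have "\<dots> = fls_nth (at_inf (map_poly d [:u:] * pderiv [:0, c:])) 0"
      unfolding rdlog_upper_elementary[OF n] fls_coeff_derivation_at_inf[OF d] at_inf_mult
      using n by (simp add: single_mat_def)
    also have "\<dots> = d u * c"
      by (simp add: at_inf_nth coeff_mult_0 coeff_map_poly derivation_0[OF d] pderiv_pCons)
    finally show ?thesis .
  qed
  have 2: "P.coc A (at_inf_mat ?L') = 0" if A: "A \<in> SL n" for A
  proof -
    have "at_inf_mat ?L' = addrow_mat n (at_inf [:- u:]) (Suc 0) 0"
      unfolding at_inf_addrow_mat by simp
    hence "P.coc A (at_inf_mat ?L') = fls_nth (ldlog (fls_coeff_derivation d) A $$ (0, Suc 0) *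
        fls_deriv_inv (at_inf [:- u:])) 0"
      using P.coc_low_right[OF A, of 0 "at_inf [:- u:]"] n by simp
    thus ?thesis unfolding fls_deriv_inv_at_inf by (simp add: pderiv_pCons)
  qed
  have "P.split (at_inf_mat ?L * at_inf_mat ?U) (0 + 0 + d u * c)"
    using P.split_mult[OF split_lower_elementary[OF n, of "[:u:]"]
      split_upper_elementary[OF n, of "[:0, c:]"]] by (simp only: 1) simp
  from P.split_mult[OF this split_lower_elementary[OF n, of "[:- u:]"]]
  have "P.split (at_inf_mat ?L * at_inf_mat ?U * at_inf_mat ?L') (d u * c)"
    unfolding 2[OF SL_mult[OF S(1,2)]] by simp
  moreover have "at_inf_mat (?L * ?U * ?L') = at_inf_mat ?L * at_inf_mat ?U * at_inf_mat ?L'"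
    by (simp only: at_inf_mat_mult[OF SL_D(1)[OF SL(1)] SL_D(1)[OF SL(2)]]
        at_inf_mat_mult[OF SL_D(1)[OF SL_mult[OF SL(1,2)]] SL_D(1)[OF SL(3)]])
  ultimately show ?thesis by simp
qed

lemma subgroup_dlog_hom_kernel:
  "subgroup {g \<in> congruence_subgroup n 1. dlog_hom g = 0} (SL_group n)"
proof -
  interpret G: group "SL_group n :: 'a poly mat monoid" by (rule group_SL_group)
  interpret K: subgroup "congruence_subgroup n 1 :: 'a poly mat set" "SL_group n"
    by (rule subgroup_congruence_subgroup)
  show ?thesis
  proof (rule G.subgroupI)
    show "{g \<in> congruence_subgroup n 1. dlog_hom g = 0} \<subseteq> carrier (SL_group n)"
      using K.subset by blast
    show "{g \<in> congruence_subgroup n 1. dlog_hom g = 0} \<noteq> {}" using K.one_closed dlog_hom_one by auto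
  next
    fix g assume g: "g \<in> {g \<in> congruence_subgroup n 1. dlog_hom g = 0}"
    hence "inv\<^bsub>SL_group n\<^esub> g \<in> congruence_subgroup n 1" using K.m_inv_closed by blast
    moreover from this have "dlog_hom g + dlog_hom (inv\<^bsub>SL_group n\<^esub> g) = dlog_hom (1\<^sub>m n)"
      using g G.r_inv[of g] K.subset by (subst dlog_hom_mult[symmetric]) auto
    ultimately show "inv\<^bsub>SL_group n\<^esub> g \<in> {g \<in> congruence_subgroup n 1. dlog_hom g = 0}"
      using g dlog_hom_one by simp
  next
    fix g h
    assume "g \<in> {g \<in> congruence_subgroup n 1. dlog_hom g = 0}" "h \<in> {g \<in> congruence_subgroup n 1. dlog_hom g = 0}"
    thus "g \<otimes>\<^bsub>SL_group n\<^esub> h \<in> {g \<in> congruence_subgroup n 1. dlog_hom g = 0}"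
      using dlog_hom_mult[of g h] K.m_closed[of g h] by simp
  qed
qed

lemma dlog_hom_commutator:
  assumes "g \<in> congruence_subgroup n 1" "h \<in> congruence_subgroup n 1"
  shows "g \<otimes>\<^bsub>SL_group n\<^esub> h \<otimes>\<^bsub>SL_group n\<^esub> inv\<^bsub>SL_group n\<^esub> g \<otimes>\<^bsub>SL_group n\<^esub> inv\<^bsub>SL_group n\<^esub> h
    \<in> {g \<in> congruence_subgroup n 1. dlog_hom g = 0}"
proof -
  interpret G: group "SL_group n :: 'a poly mat monoid" by (rule group_SL_group)
  interpret K: subgroup "congruence_subgroup n 1 :: 'a poly mat set" "SL_group n"
    by (rule subgroup_congruence_subgroup)
  have inv: "inv\<^bsub>SL_group n\<^esub> k \<in> congruence_subgroup n 1 \<and> dlog_hom (inv\<^bsub>SL_group n\<^esub> k) = - dlog_hom k"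
    if k: "k \<in> congruence_subgroup n 1" for k
  proof
    show i: "inv\<^bsub>SL_group n\<^esub> k \<in> congruence_subgroup n 1" using k by (rule K.m_inv_closed)
    have "k * inv\<^bsub>SL_group n\<^esub> k = 1\<^sub>m n" using G.r_inv[of k] K.subset k by auto
    hence "dlog_hom k + dlog_hom (inv\<^bsub>SL_group n\<^esub> k) = dlog_hom (1\<^sub>m n)" using dlog_hom_mult[OF k i] by simp
    also have "\<dots> = 0" by (rule dlog_hom_one)
    finally show "dlog_hom (inv\<^bsub>SL_group n\<^esub> k) = - dlog_hom k" by (simp add: eq_neg_iff_add_eq_0 add.commute)
  qed
  have gh: "g * h \<in> congruence_subgroup n 1" using K.m_closed[OF assms] by simp
  moreover have ghg: "g * h * inv\<^bsub>SL_group n\<^esub> g \<in> congruence_subgroup n 1"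
    using K.m_closed[OF gh] inv[OF assms(1)] by simp
  moreover have "g * h * inv\<^bsub>SL_group n\<^esub> g * inv\<^bsub>SL_group n\<^esub> h \<in> congruence_subgroup n 1"
    using K.m_closed[OF ghg] inv[OF assms(2)] by simp
  ultimately show ?thesis
    using dlog_hom_mult[OF ghg conjunct1[OF inv[OF assms(2)]]] dlog_hom_mult[OF gh conjunct1[OF inv[OF assms(1)]]]
      dlog_hom_mult[OF assms] inv[OF assms(1)] inv[OF assms(2)] by simp
qed

lemma dlog_hom_upper_elementary: "n \<ge> 2 \<Longrightarrow> coeff p 0 = 0 \<Longrightarrow> dlog_hom (addrow_mat n p 0 1) = 0"
  by (intro dlog_hom_eqI split_upper_elementary)

lemma dlog_hom_lower_elementary: "n \<ge> 2 \<Longrightarrow> dlog_hom (addrow_mat n p 1 0) = 0"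
  by (intro dlog_hom_eqI split_lower_elementary)

lemma elementary_congruence_subgroup:
  assumes "n \<ge> 2" "coeff p 0 = 0"
  shows "addrow_mat n p 0 1 \<in> congruence_subgroup n 1" "addrow_mat n p 1 0 \<in> congruence_subgroup n 1"
  using assms
  by (auto intro!: congruence_subgroup_1I simp: det_addrow_mat simp del: One_nat_def)

text \<open>The element is \<open>k h\<^sup>-\<^sup>1\<close>, where \<open>k\<close> is a product of two conjugates of elementary matrices
  whose diagonal is trivial modulo \<open>t\<^sup>2\<close>, and \<open>h\<close> is a product of elementary matrices in the
  congruence subgroup that agrees with \<open>k\<close> modulo \<open>t ^ l\<close>. Only the first factor of \<open>k\<close>
  contributes to \<open>dlog_hom\<close>.\<close>

lemma dlog_hom_attains_derivation:
  assumes n: "n \<ge> 2" and l: "l \<ge> 1"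
  shows "\<exists>w\<in>congruence_subgroup n l. dlog_hom w = d u"
proof -
  let ?K = "congruence_subgroup n 1 :: 'a poly mat set"
  let ?U = "\<lambda>p. addrow_mat n (p :: 'a poly) 0 1" and ?L = "\<lambda>p. addrow_mat n (p :: 'a poly) 1 0"
  note bl = addrow_mat_block2[OF n] block2_mult[OF n]
  interpret G: group "SL_group n :: 'a poly mat monoid" by (rule group_SL_group)
  interpret K: subgroup ?K "SL_group n" by (rule subgroup_congruence_subgroup)
  have K_mult: "A * B \<in> ?K" if "A \<in> ?K" "B \<in> ?K" for A B using K.m_closed[OF that] by simp
  define c t :: "'a poly" where "c = [:u:]" and "t = [:0, 1:]"
  have t0: "coeff (t * p) 0 = 0" for p by (simp add: t_def coeff_mult_0)
  define k1 where "k1 = ?L c * ?U t * ?L (- c)"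
  \<comment> \<open>Chosen so that its diagonal cancels that of \<open>k1\<close> to first order in
    \<open>t\<close>. Its conjugating parameter is 1, so its value is a multiple of
    \<open>d 1 = 0\<close>.\<close>
  define k2 where "k2 = ?L 1 * ?U (- c * t) * ?L (- 1)"
  have k1: "k1 = block2 n (1 - c * t) t (- c * c * t) (1 + c * t)"
    unfolding k1_def bl by (simp add: algebra_simps)
  have k2: "k2 = block2 n (1 + c * t) (- c * t) (c * t) (1 - c * t)"
    unfolding k2_def bl by (simp add: algebra_simps)
  have SL: "k1 \<in> SL n" "k2 \<in> SL n"
    unfolding k1_def k2_def by (intro SL_mult addrow_mat_SL; simp)+
  have t_dvd: "[:0, 1:] ^ 1 dvd x * t" for x :: "'a poly"
    unfolding t_power_one_dvd_iff by (simp add: t_def coeff_mult_0)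
  have K: "k1 \<in> ?K"
    using SL(1) t_dvd[of 1] t_dvd[of "- c"] t_dvd[of "- c * c"] t_dvd[of c] unfolding k1
    by (intro block2_congruence_subgroup[OF n]) simp_all
  have K2: "k2 \<in> ?K"
    using SL(2) t_dvd[of "- c"] t_dvd[of c] unfolding k2
    by (intro block2_congruence_subgroup[OF n]) simp_all
  have psi1: "dlog_hom k1 = d u"
    using dlog_hom_eqI[OF split_conjugate[OF n, of u 1]] by (simp add: k1_def c_def t_def)
  have psi2: "dlog_hom k2 = 0"
    using dlog_hom_eqI[OF split_conjugate[OF n, of 1 "- u"]] derivation_1[OF d]
    by (simp add: k2_def c_def t_def one_pCons)
  define a where "a = 1 + (c - c * c) * t * t"
  define k12 k21 k22 where "k12 = (1 - c) * (1 - c * t) * t" and "k21 = (1 - c) * (1 + c * t) * c * t"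
    and "k22 = 1 - c * c * t * t + c * c * c * t * t"
  have k: "k1 * k2 = block2 n a k12 k21 k22"
    unfolding k1 k2 bl a_def k12_def k21_def k22_def by (simp add: algebra_simps)
  have kdet: "a * k22 - k12 * k21 = 1"
    unfolding a_def k12_def k21_def k22_def by (simp add: algebra_simps)
  \<comment> \<open>This makes \<open>a = 1 + t * r\<close>, the upper left entry of
    \<open>?U t * ?L r\<close>.\<close>
  define r where "r = (c - c * c) * t"
  have "coeff a 0 = 1" by (simp add: a_def coeff_mult_0 t_def)
  then obtain s where s: "[:0, 1:] ^ l dvd a * s - 1" using inverse_mod_t_power by blast
  \<comment> \<open>With \<open>s\<close> inverting \<open>a\<close> modulo \<open>t ^ l\<close>,
    the product \<open>?L p * ?U t * ?L r * ?U q\<close> keeps the corner \<open>a\<close> and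
    matches \<open>k12\<close> and \<open>k21\<close> off the diagonal modulo
    \<open>t ^ l\<close>.\<close>
  define p q where "p = s * (k21 - r)" and "q = s * (k12 - t)"
  have coeff0: "coeff t 0 = 0" "coeff r 0 = 0" "coeff p 0 = 0" "coeff q 0 = 0"
    by (simp_all add: p_def q_def r_def k12_def k21_def t_def coeff_mult_0)
  define h12 h21 h22 where "h12 = a * q + t" and "h21 = p * a + r" and "h22 = p * (a * q + t) + r * q + 1"
  have h12: "[:0, 1:] ^ l dvd h12 - k12"
  proof -
    have "h12 - k12 = (a * s - 1) * (k12 - t)" by (simp add: h12_def q_def algebra_simps)
    thus ?thesis using s by simp
  qed
  have h21: "[:0, 1:] ^ l dvd h21 - k21"
  proof -
    have "h21 - k21 = (a * s - 1) * (k21 - r)" by (simp add: h21_def p_def algebra_simps)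
    thus ?thesis using s by simp
  qed
  have art: "a = 1 + t * r" by (simp add: a_def r_def algebra_simps)
  have hdet: "a * h22 - h12 * h21 = 1"
    unfolding h12_def h21_def h22_def art by (simp add: algebra_simps)
  \<comment> \<open>The inverse of that product; its parameters all have constant term 0, so every
    factor lies in \<open>K\<close> and has value 0.\<close>
  define h' where "h' = ?U (- q) * ?L (- r) * ?U (- t) * ?L (- p)"
  have h': "h' = block2 n h22 (- h12) (- h21) a"
    unfolding h'_def bl h12_def h21_def h22_def art by (simp add: algebra_simps)
  note elem = elementary_congruence_subgroup[OF n]
  have U: "?U (- x) \<in> ?K" "dlog_hom (?U (- x)) = 0" if "coeff x 0 = 0" for x
    using that n by (intro elem dlog_hom_upper_elementary; simp)+
  have L: "?L (- x) \<in> ?K" "dlog_hom (?L (- x)) = 0" if "coeff x 0 = 0" for x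
    using that n by (intro elem dlog_hom_lower_elementary; simp)+
  note facs = U[OF coeff0(4)] L[OF coeff0(2)] U[OF coeff0(1)] L[OF coeff0(3)]
  have h'K: "h' \<in> ?K"
    unfolding h'_def by (intro K_mult facs)
  have psih': "dlog_hom h' = 0"
    unfolding h'_def by (simp only: dlog_hom_mult K_mult facs add_0_left)
  have kK: "k1 * k2 \<in> ?K" by (rule K_mult[OF K K2])
  have dlog_hom: "dlog_hom (k1 * k2 * h') = d u"
    by (simp add: dlog_hom_mult[OF kK h'K] dlog_hom_mult[OF K K2] psi1 psi2 psih')
  have wSL: "k1 * k2 * h' \<in> SL n" by (rule congruence_subgroup_SL[OF K_mult[OF kK h'K]])
  have w: "k1 * k2 * h' = block2 n (a * h22 - k12 * h21) (k12 * a - a * h12)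
      (k21 * h22 - k22 * h21) (k22 * a - k21 * h12)"
    unfolding k h' bl by (simp add: algebra_simps)
  have "k1 * k2 * h' \<in> congruence_subgroup n l"
    using wSL unfolding w
    by (rule block2_congruence_subgroup[OF n _ congruence_of_block2[OF s kdet hdet h12 h21]])
  thus ?thesis using dlog_hom by blast
qed

end

section \<open>From the homomorphism to the lower central series\<close>

text \<open>Every term is generated by commutators of \<open>H\<close> with a subset of
  \<open>H\<close>, so from the second term on the series stays in \<open>N\<close>.\<close>

lemma lower_central_series_subset:
  fixes G (structure)
  assumes "group G" "subgroup N G" "N \<subseteq> H"
    and comm: "\<And>g h. g \<in> H \<Longrightarrow> h \<in> H \<Longrightarrow> g \<otimes> h \<otimes> inv g \<otimes> inv h \<in> N"
  shows "lower_central_series G H (Suc (Suc i)) \<subseteq> N"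
proof -
  interpret group G by fact
  have step: "commutator_subgroup G H L \<subseteq> N" if "L \<subseteq> H" for L
    unfolding commutator_subgroup_def
    using that comm by (intro generate_subgroup_incl[OF _ assms(2)]) auto
  show ?thesis
  proof (induction i)
    case 0
    show ?case using step[of H] by simp
  next
    case (Suc i)
    show ?case
      unfolding lower_central_series.simps(3)[of G H "Suc i"]
      using Suc.IH assms(3) by (intro step) blast
  qed
qed

text \<open>If every \<open>kaehler_d u\<close> were zero, uniqueness in the universal property
  would identify the identity map with the zero map. A linear functional that is 1 on some nonzero
  \<open>kaehler_d u\<close> then turns the universal derivation into one with values in the
  field.\<close>

lemma exists_nonzero_derivation:
  assumes "(UNIV :: 'a::field kaehler set) \<noteq> {0}"
  shows "\<exists>d :: 'a \<Rightarrow> 'a. derivation d \<and> (\<exists>u. d u \<noteq> 0)"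
proof -
  interpret K: vector_space "kaehler_scale :: 'a \<Rightarrow> 'a kaehler \<Rightarrow> _"
    by unfold_locales (simp_all add: kaehler.scale_right_distrib kaehler.scale_left_distrib)
  interpret F: vector_space "(*) :: 'a \<Rightarrow> 'a \<Rightarrow> 'a"
    by unfold_locales (simp_all add: algebra_simps)
  interpret KF: vector_space_pair "kaehler_scale :: 'a \<Rightarrow> 'a kaehler \<Rightarrow> _" "(*) :: 'a \<Rightarrow> 'a \<Rightarrow> 'a"
    by unfold_locales
  obtain u :: 'a where u: "kaehler_d u \<noteq> 0"
  proof -
    have "\<exists>u :: 'a. kaehler_d u \<noteq> 0"
    proof (rule ccontr)
      assume "\<not> ?thesis"
      hence z: "kaehler_d x = 0" for x :: 'a by blast
      have "Modules.module_hom kaehler_scale kaehler_scale (\<lambda>w :: 'a kaehler. w)"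
        "Modules.module_hom kaehler_scale kaehler_scale (\<lambda>w :: 'a kaehler. 0 :: 'a kaehler)"
        by unfold_locales simp_all
      moreover have "\<exists>!\<phi>. Modules.module_hom kaehler_scale kaehler_scale \<phi> \<and>
          (\<forall>x :: 'a. \<phi> (kaehler_d x) = kaehler_d x)"
        by (rule kaehler_universal[OF kaehler.module_axioms kaehler_d_add kaehler_d_mult])
      ultimately have "(\<lambda>w :: 'a kaehler. w) = (\<lambda>w. 0)"
        using z by (elim ex1E) (metis (no_types, lifting))
      hence "w = 0" for w :: "'a kaehler" by (rule fun_cong)
      thus False using assms by blast
    qed
    thus thesis using that by blast
  qed
  obtain g where g: "Vector_Spaces.linear kaehler_scale ((*) :: 'a \<Rightarrow> 'a \<Rightarrow> 'a) g"
    and gu: "g (kaehler_d u) = 1"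
    using KF.linear_independent_extend[of "{kaehler_d u}" "\<lambda>_. 1"] u by auto
  interpret g: Vector_Spaces.linear kaehler_scale "(*) :: 'a \<Rightarrow> 'a \<Rightarrow> 'a" g by (rule g)
  have "derivation (\<lambda>x. g (kaehler_d x))"
    by (simp add: derivation_def kaehler_d_add kaehler_d_mult g.add g.scale mult.commute)
  thus ?thesis using gu by (metis zero_neq_one)
qed

theorem proposition7p5:
  fixes n :: nat
  assumes "n \<ge> 2"
    and "(CHAR('a::field) \<noteq> 2 \<and> CHAR('a) \<noteq> 3) \<or> is_perfect_field TYPE('a)"
    and "(UNIV :: 'a kaehler set) \<noteq> {0}"
  shows "\<forall>l::nat. l \<ge> 2 \<longrightarrow>
           (congruence_subgroup n l :: 'a poly mat set) \<noteq>
             lower_central_series (SL_group n) (congruence_subgroup n 1) l"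
proof (intro allI impI notI)
  fix l :: nat
  assume l: "l \<ge> 2"
    and eq: "(congruence_subgroup n l :: 'a poly mat set) =
      lower_central_series (SL_group n) (congruence_subgroup n 1) l"
  obtain d :: "'a \<Rightarrow> 'a" and u where d: "derivation d" and u: "d u \<noteq> 0"
    using exists_nonzero_derivation[OF assms(3)] by blast
  obtain w where w: "w \<in> congruence_subgroup n l" "dlog_hom d n w = d u"
    using dlog_hom_attains_derivation[OF d assms(1), of l u] l by auto
  \<comment> \<open>The index is written so that the series is at its second term or later, where
    the kernel of \<open>dlog_hom\<close> contains it; \<open>w\<close> lies outside that
    kernel.\<close>
  have "lower_central_series (SL_group n) (congruence_subgroup n 1) (Suc (Suc (l - 2))) \<subseteq>
      {g \<in> congruence_subgroup n 1. dlog_hom d n g = 0}"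
    by (intro lower_central_series_subset group_SL_group subgroup_dlog_hom_kernel[OF d]
        dlog_hom_commutator[OF d]) auto
  moreover have "Suc (Suc (l - 2)) = l" using l by simp
  ultimately have "w \<in> {g \<in> congruence_subgroup n 1. dlog_hom d n g = 0}" using w(1) eq by auto
  thus False using w(2) u by simp
qed

end
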